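(* In the universal Askey-Wilson algebra $\Delta_q$, let $\{W_{-k}\}_{k\in\mathbb N}$, $\{W_{k+1}\}_{k\in\mathbb N}$, $\{G_{k+1}\}_{k\in\mathbb N}$, $\{\tilde G_{k+1}\}_{k\in\mathbb N}$ denote the images under the homomorphism $\natural:\mathcal O_q\to\Delta_q$ of the elements of the $q$-Onsager algebra $\mathcal O_q$ with the same names defined in the context. Then, with $\rho=-(q^2-q^{-2})^2$, the following relations hold in $\Delta_q$ for all $k,\ell\in\mathbb N$: $$[W_0,W_{k+1}]=[W_{-k},W_1]=(\tilde G_{k+1}-G_{k+1})/(q+q^{-1}),$$ $$[W_0,G_{k+1}]_q=[\tilde G_{k+1},W_0]_q=\rho W_{-k-1}-\rho W_{k+1},$$ $$[G_{k+1},W_1]_q=[W_1,\tilde G_{k+1}]_q=\rho W_{k+2}-\rho W_{-k},$$ $$[W_{-k},W_{-\ell}]=0,\qquad [W_{k+1},W_{\ell+1}]=0,$$ $$[W_{-k},W_{\ell+1}]+[W_{k+1},W_{-\ell}]=0,$$ $$[W_{-k},G_{\ell+1}]+[G_{k+1},W_{-\ell}]=0,$$ $$[W_{-k},\tilde G_{\ell+1}]+[\tilde G_{k+1},W_{-\ell}]=0,$$ $$[W_{k+1},G_{\ell+1}]+[G_{k+1},W_{\ell+1}]=0,$$ $$[W_{k+1},\tilde G_{\ell+1}]+[\tilde G_{k+1},W_{\ell+1}]=0,$$ $$[G_{k+1},G_{\ell+1}]=0,\qquad [\tilde G_{k+1},\tilde G_{\ell+1}]=0,$$ $$[\tilde G_{k+1},G_{\ell+1}]+[G_{k+1},\tilde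 G_{\ell+1}]=0.$$
   Context: Conventions. $\mathbb F$ is a field; all algebras are associative, unital, over $\mathbb F$; $\mathbb N=\{0,1,2,\ldots\}$; $q\in\mathbb F$ is nonzero and not a root of unity; $[n]_q=(q^n-q^{-n})/(q-q^{-1})$; $[X,Y]=XY-YX$; $[X,Y]_q=qXY-q^{-1}YX$. A generating function over an algebra is a formal power series $a(t)=\sum_{n\in\mathbb N}a_nt^n$ with coefficients in that algebra ($t$ commutes with everything). It is normalized if $a_0=1$, and commutative if its coefficients mutually commute. If $0\ne a_0\in\mathbb F$, put $a(t)^\vee=a_0^{-1}a(t)$. $q$-expansion. Let $a(t)=\sum_n a_nt^n$ be commutative and normalized. Its $q$-expansion is the unique generating function $b(t)=\sum_n b_nt^n$ (over the commutative subalgebra generated by the $a_n$) such that $b_0=1$ and for $n\ge1$ $$0=[n]_q a_n+\sum_{j+k+2\ell+1=n,\ j,k,\ell\ge0}(-1)^\ell\binom{k+\ell}{\ell}[2n-j]_q[2]_q^{k+1}a_jb_{k+1}.$$ Equivalently, $b_0=1$ and $a(t)\,b\bigl(\frac{q+q^{-1}}{qt+q^{-1}t^{-1}}\bigr)\,b\bigl(\frac{q+q^{-1}}{q^{-1}t+qt^{-1}}\bigr)=1$, where $\frac{1}{ct+c^{-1}t^{-1}}$ is expanded as $\frac{ct}{1+c^2t^2}=\sum_{n\in\mathbb N}(-1)^nc^{2n+1}t^{2n+1}$. The $q$-Onsager algebra $\mathcal O_q$ is defined by generators $W_0,W_1$ and relations $[W_0,[W_0,[W_0,W_1]_q]_{q^{-1}}]=(q^2-q^{-2})^2[W_1,W_0]$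 and $[W_1,[W_1,[W_1,W_0]_q]_{q^{-1}}]=(q^2-q^{-2})^2[W_0,W_1]$. Elements $B_{n\delta+\alpha_0},B_{n\delta+\alpha_1}$ ($n\ge0$), $B_{n\delta}$ ($n\ge1$) of $\mathcal O_q$: $B_\delta=q^{-2}W_1W_0-W_0W_1$; $B_{\alpha_0}=W_0$, $B_{\delta+\alpha_0}=W_1+\frac{q[B_\delta,W_0]}{(q-q^{-1})(q^2-q^{-2})}$, $B_{n\delta+\alpha_0}=B_{(n-2)\delta+\alpha_0}+\frac{q[B_\delta,B_{(n-1)\delta+\alpha_0}]}{(q-q^{-1})(q^2-q^{-2})}$ for $n\ge2$; $B_{\alpha_1}=W_1$, $B_{\delta+\alpha_1}=W_0-\frac{q[B_\delta,W_1]}{(q-q^{-1})(q^2-q^{-2})}$, $B_{n\delta+\alpha_1}=B_{(n-2)\delta+\alpha_1}-\frac{q[B_\delta,B_{(n-1)\delta+\alpha_1}]}{(q-q^{-1})(q^2-q^{-2})}$ for $n\ge2$; and for $n\ge2$, $B_{n\delta}=q^{-2}B_{(n-1)\delta+\alpha_1}W_0-W_0B_{(n-1)\delta+\alpha_1}+(q^{-2}-1)\sum_{\ell=0}^{n-2}B_{\ell\delta+\alpha_1}B_{(n-\ell-2)\delta+\alpha_1}$. It is known (Baseilhac–Kolb) that the $B_{n\delta}$ mutually commute. Put $B_{0\delta}=q^{-2}-1$ and $B(t)=\sum_{n\in\mathbb N}B_{n\delta}t^n$. Elements $W_{-k},W_{k+1},G_{k+1},\tilde G_{k+1}$ ($k\in\mathbb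 N$) of $\mathcal O_q$. (i) With $\tilde G_0=-(q-q^{-1})[2]_q^2$ and $\tilde G(t)=\sum_{n\in\mathbb N}\tilde G_nt^n$, the series $\tilde G(t)^\vee$ is the $q$-expansion of $B(t)^\vee$. (ii) $W_0,W_1$ are the generators; for odd $k=2r+1\ge1$, $$W_{-k}=W_1-\sum_{\ell=0}^r\frac{[\tilde G_{2\ell+1},W_0]_q}{(q^2-q^{-2})^2}-\sum_{\ell=1}^r\frac{[W_1,\tilde G_{2\ell}]_q}{(q^2-q^{-2})^2},\quad W_{k+1}=W_0-\sum_{\ell=0}^r\frac{[W_1,\tilde G_{2\ell+1}]_q}{(q^2-q^{-2})^2}-\sum_{\ell=1}^r\frac{[\tilde G_{2\ell},W_0]_q}{(q^2-q^{-2})^2},$$ and for even $k=2r\ge2$, $$W_{-k}=W_0-\sum_{\ell=0}^{r-1}\frac{[W_1,\tilde G_{2\ell+1}]_q}{(q^2-q^{-2})^2}-\sum_{\ell=1}^r\frac{[\tilde G_{2\ell},W_0]_q}{(q^2-q^{-2})^2},\quad W_{k+1}=W_1-\sum_{\ell=0}^{r-1}\frac{[\tilde G_{2\ell+1},W_0]_q}{(q^2-q^{-2})^2}-\sum_{\ell=1}^r\frac{[W_1,\tilde G_{2\ell}]_q}{(q^2-q^{-2})^2}.$$ (iii) $G_{k+1}=\tilde G_{k+1}+(q+q^{-1})[W_1,W_{-k}]$ for $k\in\mathbb N$. The universal Askey-Wilson algebra $\Delta_q$ is defined by generators $A,B,C$ and relations asserting that each of $A+\frac{qBC-q^{-1}CB}{q^2-q^{-2}}$,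 $B+\frac{qCA-q^{-1}AC}{q^2-q^{-2}}$, $C+\frac{qAB-q^{-1}BA}{q^2-q^{-2}}$ is central. It is known that there is an algebra homomorphism $\natural:\mathcal O_q\to\Delta_q$ with $W_0\mapsto A$, $W_1\mapsto B$. *)

theory Defs
  imports
    "HOL-Algebra.Module" "HOL-Algebra.QuotRing" "HOL-Algebra.Subrings"
    "HOL-Library.Poly_Mapping"
begin

section \<open>Associative unital algebras over a field\<close>

text \<open>The ground field is a type \<open>'f\<close> of class \<^class>\<open>field\<close>. Algebras are carrier-based
  \<^type>\<open>module\<close> records, since the algebras below depend on the parameter \<open>q\<close>. The locale
  \<^locale>\<open>algebra\<close> of the library covers commutative algebras only.\<close>

locale f_algebra = ring M for M :: "('f::field, 'a, 'm) module_scheme" (structure) +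
  assumes smult_closed [simp, intro]: "x \<in> carrier M \<Longrightarrow> c \<odot> x \<in> carrier M"
    and smult_l_distr: "x \<in> carrier M \<Longrightarrow> (c + d) \<odot> x = c \<odot> x \<oplus> d \<odot> x"
    and smult_r_distr: "x \<in> carrier M \<Longrightarrow> y \<in> carrier M \<Longrightarrow> c \<odot> (x \<oplus> y) = c \<odot> x \<oplus> c \<odot> y"
    and smult_assoc1: "x \<in> carrier M \<Longrightarrow> (c * d) \<odot> x = c \<odot> (d \<odot> x)"
    and smult_one [simp]: "x \<in> carrier M \<Longrightarrow> 1 \<odot> x = x"
    and smult_mult_l: "x \<in> carrier M \<Longrightarrow> y \<in> carrier M \<Longrightarrow> (c \<odot> x) \<otimes> y = c \<odot> (x \<otimes> y)"
    and smult_mult_r: "x \<in> carrier M \<Longrightarrow> y \<in> carrier M \<Longrightarrow> x \<otimes> (c \<odot> y) = c \<odot> (x \<otimes> y)"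

definition f_algebra_hom ::
  "('f::field, 'a, 'm) module_scheme \<Rightarrow> ('f, 'b, 'n) module_scheme \<Rightarrow> ('a \<Rightarrow> 'b) set"
  where "f_algebra_hom M N =
    {h \<in> ring_hom M N. \<forall>c. \<forall>x\<in>carrier M. h (c \<odot>\<^bsub>M\<^esub> x) = c \<odot>\<^bsub>N\<^esub> h x}"

definition generated_subalgebra :: "('f::field, 'a, 'm) module_scheme \<Rightarrow> 'a set \<Rightarrow> 'a set"
  where "generated_subalgebra M X =
    \<Inter>{S. subring S M \<and> (\<forall>c. \<forall>x\<in>S. c \<odot>\<^bsub>M\<^esub> x \<in> S) \<and> X \<subseteq> S}"

definition commutator :: "('f::field, 'a, 'm) module_scheme \<Rightarrow> 'a \<Rightarrow> 'a \<Rightarrow> 'a"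
  where "commutator M x y = x \<otimes>\<^bsub>M\<^esub> y \<ominus>\<^bsub>M\<^esub> y \<otimes>\<^bsub>M\<^esub> x"

definition q_commutator :: "('f::field, 'a, 'm) module_scheme \<Rightarrow> 'f \<Rightarrow> 'a \<Rightarrow> 'a \<Rightarrow> 'a"
  where "q_commutator M q x y =
    q \<odot>\<^bsub>M\<^esub> (x \<otimes>\<^bsub>M\<^esub> y) \<ominus>\<^bsub>M\<^esub> inverse q \<odot>\<^bsub>M\<^esub> (y \<otimes>\<^bsub>M\<^esub> x)"


section \<open>Algebras defined by generators and relations\<close>

text \<open>The free algebra is the monoid algebra of the free monoid: finitely supported functions
  on words, whose product is the convolution product of \<^type>\<open>poly_mapping\<close>. That product uses
  the additive notation for the monoid, so \<open>+\<close> on words is concatenation.\<close>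

datatype 'g fword = Fword "'g list"

instantiation fword :: (type) monoid_add
begin

definition zero_fword :: "'g fword" where "zero_fword = Fword []"

fun plus_fword :: "'g fword \<Rightarrow> 'g fword \<Rightarrow> 'g fword"
  where "plus_fword (Fword u) (Fword v) = Fword (u @ v)"

instance
proof
  fix a b c :: "'g fword"
  show "a + b + c = a + (b + c)" by (cases a; cases b; cases c) simp
  show "0 + a = a" "a + 0 = a" by (cases a; simp add: zero_fword_def)+
qed

end

definition free_algebra :: "('f::field, 'g fword \<Rightarrow>\<^sub>0 'f) module"
  where "free_algebra = \<lparr>carrier = UNIV, mult = (*), one = 1, zero = 0, add = (+),
    smult = (\<lambda>c. Poly_Mapping.map ((*) c))\<rparr>"

definition free_gen :: "'g \<Rightarrow> ('g fword \<Rightarrow>\<^sub>0 'f::field)"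
  where "free_gen g = Poly_Mapping.single (Fword [g]) 1"

definition quotient_algebra ::
  "('f::field, 'a, 'm) module_scheme \<Rightarrow> 'a set \<Rightarrow> ('f, 'a set) module"
  where "quotient_algebra M I =
    ring.extend (M Quot I) (module.fields (\<lambda>c X. \<Union>x\<in>X. I +>\<^bsub>M\<^esub> (c \<odot>\<^bsub>M\<^esub> x)))"

definition presented_algebra ::
  "('g fword \<Rightarrow>\<^sub>0 'f::field) set \<Rightarrow> ('f, ('g fword \<Rightarrow>\<^sub>0 'f) set) module"
  where "presented_algebra S = quotient_algebra free_algebra (Idl\<^bsub>free_algebra\<^esub> S)"

definition presented_gen ::
  "('g fword \<Rightarrow>\<^sub>0 'f::field) set \<Rightarrow> 'g \<Rightarrow> ('g fword \<Rightarrow>\<^sub>0 'f) set"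
  where "presented_gen S g = Idl\<^bsub>free_algebra\<^esub> S +>\<^bsub>free_algebra\<^esub> free_gen g"

lemma free_algebra_simps [simp]:
  "carrier free_algebra = UNIV" "mult free_algebra = (*)" "one free_algebra = 1"
  "zero free_algebra = 0" "add free_algebra = (+)"
  by (simp_all add: free_algebra_def)

lemma smult_free_algebra: "c \<odot>\<^bsub>free_algebra\<^esub> x = Poly_Mapping.single 0 c * x"
  by (simp add: free_algebra_def mult_map_scale_conv_mult)

lemma single_0_commute:
  "x * Poly_Mapping.single 0 c = Poly_Mapping.single 0 c * (x :: 'g fword \<Rightarrow>\<^sub>0 'f::field)"
proof (induction x rule: update_induct)
  case (update f a b)
  have "Poly_Mapping.update a b f = f + Poly_Mapping.single a b"
    using update(1) by (intro poly_mapping_eqI) (auto simp: lookup_update lookup_add lookup_single in_keys_iff)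
  with update show ?case
    by (simp add: distrib_left distrib_right mult_single mult.commute)
qed simp

lemma ring_free_algebra: "ring (free_algebra :: ('f::field, 'g fword \<Rightarrow>\<^sub>0 'f) module)"
proof (rule ringI)
  show "abelian_group (free_algebra :: ('f, 'g fword \<Rightarrow>\<^sub>0 'f) module)"
  proof (rule abelian_groupI)
    fix x :: "'g fword \<Rightarrow>\<^sub>0 'f"
    show "\<exists>y\<in>carrier free_algebra. y \<oplus>\<^bsub>free_algebra\<^esub> x = \<zero>\<^bsub>free_algebra\<^esub>"
      by (auto intro: exI[of _ "- x"])
  qed (simp_all add: add.assoc add.commute)
  show "Group.monoid (free_algebra :: ('f, 'g fword \<Rightarrow>\<^sub>0 'f) module)"
    by (rule monoidI) (simp_all add: mult.assoc)
qed (simp_all add: distrib_left distrib_right)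

lemma f_algebra_free_algebra: "f_algebra (free_algebra :: ('f::field, 'g fword \<Rightarrow>\<^sub>0 'f) module)"
proof -
  have "x * (Poly_Mapping.single 0 c * y) = Poly_Mapping.single 0 c * (x * y)"
    for c :: 'f and x y :: "'g fword \<Rightarrow>\<^sub>0 'f"
    by (simp add: mult.assoc[symmetric] single_0_commute)
  then show ?thesis
    by (intro f_algebra.intro f_algebra_axioms.intro ring_free_algebra)
      (simp_all add: smult_free_algebra single_add distrib_left distrib_right mult_single
        mult.assoc[symmetric])
qed

lemma (in f_algebra) ideal_smult_closed:
  assumes "ideal I M" "x \<in> I" shows "c \<odot> x \<in> I"
proof -
  interpret ideal I M by fact
  have "c \<odot> x = (c \<odot> \<one>) \<otimes> x" using assms by (simp add: smult_mult_l a_Hcarr)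
  then show ?thesis using assms by (simp add: I_l_closed)
qed

lemma (in f_algebra) quotient_algebra_simps:
  assumes "ideal I M"
  shows "carrier (quotient_algebra M I) = a_rcosets I"
    and "mult (quotient_algebra M I) = rcoset_mult M I"
    and "one (quotient_algebra M I) = I +> \<one>"
    and "zero (quotient_algebra M I) = I"
    and "add (quotient_algebra M I) = set_add M"
    and "x \<in> carrier M \<Longrightarrow> c \<odot>\<^bsub>quotient_algebra M I\<^esub> (I +> x) = I +> (c \<odot> x)"
proof -
  interpret ideal I M by fact
  show "carrier (quotient_algebra M I) = a_rcosets I"
    "mult (quotient_algebra M I) = rcoset_mult M I"
    "one (quotient_algebra M I) = I +> \<one>"
    "zero (quotient_algebra M I) = I"
    "add (quotient_algebra M I) = set_add M"
    by (simp_all add: quotient_algebra_def FactRing_def ring.defs module.defs)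
  assume x: "x \<in> carrier M"
  have "I +> (c \<odot> y) = I +> (c \<odot> x)" if y: "y \<in> I +> x" for y
  proof -
    obtain h where h: "h \<in> I" "y = h \<oplus> x" using y by (auto simp: a_r_coset_def')
    then have "c \<odot> y = c \<odot> h \<oplus> c \<odot> x" using x by (simp add: smult_r_distr a_Hcarr)
    then have "c \<odot> y \<in> I +> (c \<odot> x)"
      using ideal_smult_closed[OF assms h(1)] by (auto simp: a_r_coset_def')
    then show ?thesis using x a_repr_independence' by (metis smult_closed)
  qed
  then have "(\<Union>y\<in>I +> x. I +> (c \<odot> y)) = I +> (c \<odot> x)"
    using a_rcos_self[OF x] by blast
  then show "c \<odot>\<^bsub>quotient_algebra M I\<^esub> (I +> x) = I +> (c \<odot> x)"
    by (simp add: quotient_algebra_def FactRing_def ring.defs module.defs)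
qed

lemma (in f_algebra) f_algebra_quotient_algebra:
  assumes "ideal I M" shows "f_algebra (quotient_algebra M I)"
proof -
  interpret ideal I M by fact
  interpret Q: ring "M Quot I" by (rule quotient_is_ring)
  note s = quotient_algebra_simps[OF assms]
  have e: "carrier (M Quot I) = a_rcosets I" "mult (M Quot I) = rcoset_mult M I"
    "one (M Quot I) = I +> \<one>" "zero (M Quot I) = I" "add (M Quot I) = set_add M"
    by (simp_all add: FactRing_def)
  have r: "ring (quotient_algebra M I)"
    using Q.a_assoc Q.m_assoc Q.a_comm Q.l_distr Q.r_distr Q.add.l_inv_ex
      Q.a_closed Q.m_closed Q.zero_closed Q.one_closed Q.l_zero Q.l_one Q.r_one
    unfolding e by (intro ringI abelian_groupI monoidI) (simp_all only: s)
  have c: "\<And>X. X \<in> a_rcosets I \<Longrightarrow> \<exists>x\<in>carrier M. X = I +> x"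
    by (auto simp: A_RCOSETS_def')
  have c': "\<And>x. x \<in> carrier M \<Longrightarrow> I +> x \<in> a_rcosets I"
    by (auto simp: A_RCOSETS_def')
  show ?thesis
    by (intro f_algebra.intro f_algebra_axioms.intro r; unfold s(1))
      (auto dest!: c simp: s c' a_rcos_sum rcoset_mult_add smult_l_distr smult_r_distr smult_assoc1
        smult_mult_l smult_mult_r)
qed

lemma f_algebra_presented_algebra: "f_algebra (presented_algebra S)"
  unfolding presented_algebra_def
  by (intro f_algebra.f_algebra_quotient_algebra f_algebra_free_algebra
      ring.genideal_ideal ring_free_algebra) simp


section \<open>The $q$-expansion\<close>

definition qint :: "'f::field \<Rightarrow> nat \<Rightarrow> 'f"
  where "qint q n = (q ^ n - inverse q ^ n) / (q - inverse q)"

text \<open>A generating function is represented by its sequence of coefficients. In every nonzero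
  summand below \<open>j < n\<close>, so the subtraction \<open>2 * n - j\<close> does not truncate.\<close>

definition is_q_expansion ::
  "('f::field, 'a, 'm) module_scheme \<Rightarrow> 'f \<Rightarrow> (nat \<Rightarrow> 'a) \<Rightarrow> (nat \<Rightarrow> 'a) \<Rightarrow> bool"
  where "is_q_expansion M q a b \<longleftrightarrow>
    range b \<subseteq> generated_subalgebra M (range a) \<and>
    b 0 = \<one>\<^bsub>M\<^esub> \<and>
    (\<forall>n\<ge>1. \<zero>\<^bsub>M\<^esub> = qint q n \<odot>\<^bsub>M\<^esub> a n \<oplus>\<^bsub>M\<^esub>
      finsum M (\<lambda>(j, k, l). ((-1) ^ l * of_nat ((k + l) choose l) * qint q (2 * n - j)
          * qint q 2 ^ (k + 1)) \<odot>\<^bsub>M\<^esub> (a j \<otimes>\<^bsub>M\<^esub> b (k + 1)))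
        {(j, k, l). j + k + 2 * l + 1 = n})"

definition q_expansion :: "('f::field, 'a, 'm) module_scheme \<Rightarrow> 'f \<Rightarrow> (nat \<Rightarrow> 'a) \<Rightarrow> nat \<Rightarrow> 'a"
  where "q_expansion M q a = (THE b. is_q_expansion M q a b)"


lemma (in f_algebra) generated_subalgebra_closed:
  assumes "X \<subseteq> carrier M"
  defines "S \<equiv> generated_subalgebra M X"
  shows "subring S M" "X \<subseteq> S" "x \<in> S \<Longrightarrow> c \<odot> x \<in> S"
proof -
  have car: "carrier M \<in> {S. subring S M \<and> (\<forall>c. \<forall>x\<in>S. c \<odot> x \<in> S) \<and> X \<subseteq> S}"
    using assms(1) carrier_is_subring by auto
  then have "S \<subseteq> carrier M"
    unfolding S_def generated_subalgebra_def by blast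
  then show "subring S M"
    by (rule subringI) (auto simp: S_def generated_subalgebra_def dest: subringE)
  show "X \<subseteq> S" "x \<in> S \<Longrightarrow> c \<odot> x \<in> S"
    by (auto simp: S_def generated_subalgebra_def)
qed

lemma qint_nonzero:
  assumes "q \<noteq> 0" "\<forall>n>0. q ^ n \<noteq> 1" "n > 0"
  shows "qint q n \<noteq> 0"
proof -
  have "q ^ m \<noteq> inverse q ^ m" if "m > 0" for m
  proof
    assume "q ^ m = inverse q ^ m"
    then have "q ^ (m + m) = 1"
      using assms(1) by (metis power_add power_inverse power_not_zero right_inverse)
    then show False using assms(2) that by simp
  qed
  from this[of n] this[of 1] show ?thesis
    using assms(3) by (simp add: qint_def)
qed

text \<open>The recursion has exactly one solution, so the description operator in
  \<^const>\<open>q_expansion\<close> picks it. Commutativity of \<open>a\<close> is not needed for this.\<close>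

lemma (in f_algebra) ex1_q_expansion:
  assumes q: "q \<noteq> 0" "\<forall>n>0. q ^ n \<noteq> 1"
    and a: "range a \<subseteq> carrier M" "a 0 = \<one>"
  shows "\<exists>!b. is_q_expansion M q a b"
proof -
  define S where "S = generated_subalgebra M (range a)"
  note gen = generated_subalgebra_closed[OF a(1), folded S_def]
  note sub = subringE[OF gen(1)]
  have SM: "x \<in> S \<Longrightarrow> x \<in> carrier M" for x using sub(1) by auto
  have aS: "a n \<in> S" for n using gen(2) by auto
  have sumS: "finsum M f A \<in> S" if "\<And>i. i \<in> A \<Longrightarrow> f i \<in> S" for f and A :: "(nat \<times> nat \<times> nat) set"
    using that
  proof (induction A rule: infinite_finite_induct)
    case (insert x F)
    have f: "f i \<in> S" if "i \<in> insert x F" for i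
      using insert(4) that by blast
    have "finsum M f F \<in> S" using insert(3) f by blast
    with insert f show ?case
      by (subst finsum_insert) (blast intro: SM sub(7))+
  qed (use sub in auto)
  define t where "t b n = (\<lambda>(j, k, l). ((-1) ^ l * of_nat ((k + l) choose l) * qint q (2 * n - j)
          * qint q 2 ^ (k + 1)) \<odot> (a j \<otimes> b (k + 1)))" for b and n :: nat
  define T :: "nat \<Rightarrow> (nat \<times> nat \<times> nat) set"
    where "T n = {(j, k, l). j + k + 2 * l + 1 = n \<and> k + 1 < n}" for n
  define D where "D n = qint q (2 * n) * qint q 2 ^ n" for n
  define st where "st b n = qint q n \<odot> a n \<oplus> finsum M (t b n) (T n)" for b n
  have D: "D n \<noteq> 0" if "n > 0" for n
    using qint_nonzero[OF q] that by (simp add: D_def)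
  have finT: "finite (T n)" for n
    by (rule finite_subset[of _ "{..n} \<times> {..n} \<times> {..n}"]) (auto simp: T_def)
  have tS: "t b n i \<in> S" if "\<And>m. m < n \<Longrightarrow> b m \<in> S" "i \<in> T n" for b n i
    using that aS by (auto simp: t_def T_def intro!: gen(3) sub(6))
  have stS: "st b n \<in> S" if "\<And>m. m < n \<Longrightarrow> b m \<in> S" for b n
    unfolding st_def using that by (intro sub(7) gen(3) aS sumS tS) auto
  have st_cong: "st b n = st b' n" if "\<And>m. m < n \<Longrightarrow> b m = b' m" "\<And>m. m < n \<Longrightarrow> b m \<in> S" for b b' n
  proof -
    have "finsum M (t b n) (T n) = finsum M (t b' n) (T n)"
    proof (rule finsum_cong')
      show "t b' n \<in> T n \<rightarrow> carrier M" using tS[of n b'] that by (auto intro!: SM)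
      show "t b n i = t b' n i" if "i \<in> T n" for i
        using that \<open>\<And>m. m < n \<Longrightarrow> b m = b' m\<close> by (auto simp: t_def T_def)
    qed simp
    then show ?thesis by (simp add: st_def)
  qed
  have eq: "(\<zero> = qint q n \<odot> a n \<oplus> finsum M (t b n) {(j, k, l). j + k + 2 * l + 1 = n})
      \<longleftrightarrow> b n = inverse (D n) \<odot> (\<ominus> st b n)" if n: "n > 0" and b: "\<And>m. b m \<in> S" for b n
  proof -
    have set: "{(j, k, l). j + k + 2 * l + 1 = n} = insert (0, n - 1, 0) (T n)"
      using n by (auto simp: T_def)
    have new: "t b n (0, n - 1, 0) = D n \<odot> b n"
      using n b SM by (cases n) (simp_all add: t_def D_def a(2))
    have "finsum M (t b n) (insert (0, n - 1, 0) (T n)) = D n \<odot> b n \<oplus> finsum M (t b n) (T n)"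
      using tS[of n b] b n finT SM new by (subst finsum_insert) (auto simp: T_def)
    moreover have c: "finsum M (t b n) (T n) \<in> carrier M" "b n \<in> carrier M" "a n \<in> carrier M"
      using sumS[of "T n" "t b n"] tS[of n b] b SM aS by auto
    ultimately have "qint q n \<odot> a n \<oplus> finsum M (t b n) {(j, k, l). j + k + 2 * l + 1 = n}
        = D n \<odot> b n \<oplus> st b n"
      unfolding set st_def by (simp add: a_ac)
    moreover have "\<zero> = D n \<odot> b n \<oplus> st b n \<longleftrightarrow> D n \<odot> b n = \<ominus> st b n"
      using c SM[OF stS, of n b] b by (metis smult_closed minus_equality l_neg)
    moreover have "D n \<odot> b n = \<ominus> st b n \<longleftrightarrow> b n = inverse (D n) \<odot> (\<ominus> st b n)"
      using c SM[OF stS, of n b] b D[OF n]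
      by (metis a_inv_closed left_inverse right_inverse smult_assoc1 smult_one)
    ultimately show ?thesis by simp
  qed
  define P where "P b n r \<longleftrightarrow> r \<in> S \<and> ((\<forall>m<n. b m \<in> S) \<longrightarrow>
      r = (if n = 0 then \<one> else inverse (D n) \<odot> (\<ominus> st b n)))" for b n r
  have char: "is_q_expansion M q a b \<longleftrightarrow> (\<forall>n. P b n (b n))" for b
  proof (cases "range b \<subseteq> S")
    case True
    then have "b m \<in> S" for m by auto
    with eq[of _ b] show ?thesis
      unfolding is_q_expansion_def S_def[symmetric] P_def t_def by auto
  next
    case False
    then have "\<not> is_q_expansion M q a b"
      by (simp add: is_q_expansion_def S_def)
    moreover from False have "\<not> (\<forall>n. P b n (b n))"
      unfolding P_def by blast
    ultimately show ?thesis by simp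
  qed
  have "\<exists>b. \<forall>n. P b n (b n)"
  proof (rule dependent_wf_choice[OF wf_less])
    show "P b n r = P b' n r" if "\<And>m. (m, n) \<in> {(x, y). x < y} \<Longrightarrow> b m = b' m" for b b' n r
      using that st_cong[of n b b'] by (auto simp: P_def)
    show "\<exists>r. P b n r" if "\<And>m. (m, n) \<in> {(x, y). x < y} \<Longrightarrow> P b m (b m)" for b n
    proof -
      have "b m \<in> S" if "m < n" for m
        using that \<open>\<And>m. (m, n) \<in> {(x, y). x < y} \<Longrightarrow> P b m (b m)\<close> unfolding P_def by blast
      then have "st b n \<in> S" by (rule stS)
      then show ?thesis
        unfolding P_def using sub(3,5) gen(3)
        by (intro exI[of _ "if n = 0 then \<one> else inverse (D n) \<odot> (\<ominus> st b n)"]) auto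
    qed
  qed
  moreover have "b = b'" if b: "\<forall>n. P b n (b n)" and b': "\<forall>n. P b' n (b' n)" for b b'
  proof
    fix n show "b n = b' n"
    proof (induction n rule: less_induct)
      case (less n)
      then show ?case using b b' st_cong[of n b b'] by (metis P_def)
    qed
  qed
  ultimately show ?thesis unfolding char by blast
qed


section \<open>The named elements of the $q$-Onsager algebra\<close>

text \<open>The formulas are written for arbitrary elements \<open>w0\<close>, \<open>w1\<close> of an algebra \<open>M\<close>; they are
  used with \<open>M\<close> the $q$-Onsager algebra and \<open>w0\<close>, \<open>w1\<close> its two generators.\<close>

context
  fixes M :: "('f::field, 'a, 'm) module_scheme" (structure)
    and q :: 'f and w0 w1 :: 'a
begin

definition B_delta1 :: 'a
  where "B_delta1 = inverse q ^ 2 \<odot> (w1 \<otimes> w0) \<ominus> w0 \<otimes> w1"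

definition B_coeff :: 'f
  where "B_coeff = q / ((q - inverse q) * (q ^ 2 - inverse q ^ 2))"

fun B_alpha0 :: "nat \<Rightarrow> 'a" where
  "B_alpha0 0 = w0"
| "B_alpha0 (Suc 0) = w1 \<oplus> B_coeff \<odot> commutator M B_delta1 w0"
| "B_alpha0 (Suc (Suc n)) = B_alpha0 n \<oplus> B_coeff \<odot> commutator M B_delta1 (B_alpha0 (Suc n))"

fun B_alpha1 :: "nat \<Rightarrow> 'a" where
  "B_alpha1 0 = w1"
| "B_alpha1 (Suc 0) = w0 \<ominus> B_coeff \<odot> commutator M B_delta1 w1"
| "B_alpha1 (Suc (Suc n)) = B_alpha1 n \<ominus> B_coeff \<odot> commutator M B_delta1 (B_alpha1 (Suc n))"

fun B_delta :: "nat \<Rightarrow> 'a" where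
  "B_delta 0 = (inverse q ^ 2 - 1) \<odot> \<one>"
| "B_delta (Suc 0) = B_delta1"
| "B_delta (Suc (Suc m)) =
    inverse q ^ 2 \<odot> (B_alpha1 (Suc m) \<otimes> w0) \<ominus> w0 \<otimes> B_alpha1 (Suc m)
    \<oplus> (inverse q ^ 2 - 1) \<odot> (\<Oplus>l\<in>{0..m}. B_alpha1 l \<otimes> B_alpha1 (m - l))"

definition B_vee :: "nat \<Rightarrow> 'a"
  where "B_vee n = inverse (inverse q ^ 2 - 1) \<odot> B_delta n"

text \<open>The coefficients of the series whose constant term is \<open>- (q - inverse q) * qint q 2 ^ 2\<close>
  and whose normalization is the $q$-expansion of \<open>B_vee\<close>.\<close>

definition G_tilde :: "nat \<Rightarrow> 'a"
  where "G_tilde n = (- (q - inverse q) * qint q 2 ^ 2) \<odot> q_expansion M q B_vee n"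

definition W_summand0 :: "nat \<Rightarrow> 'a"
  where "W_summand0 n = inverse ((q ^ 2 - inverse q ^ 2) ^ 2) \<odot> q_commutator M q (G_tilde n) w0"

definition W_summand1 :: "nat \<Rightarrow> 'a"
  where "W_summand1 n = inverse ((q ^ 2 - inverse q ^ 2) ^ 2) \<odot> q_commutator M q w1 (G_tilde n)"

text \<open>\<open>W_neg k\<close> is $W_{-k}$ and \<open>W_pos k\<close> is $W_{k+1}$; similarly \<open>G k\<close> is $G_{k+1}$, whereas
  \<open>G_tilde n\<close> is $\tilde G_n$.\<close>

definition W_neg :: "nat \<Rightarrow> 'a"
  where "W_neg k = (let r = k div 2 in
    if k = 0 then w0
    else if odd k then
      w1 \<ominus> (\<Oplus>l\<in>{0..r}. W_summand0 (2 * l + 1)) \<ominus> (\<Oplus>l\<in>{1..r}. W_summand1 (2 * l))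
    else
      w0 \<ominus> (\<Oplus>l\<in>{0..r - 1}. W_summand1 (2 * l + 1)) \<ominus> (\<Oplus>l\<in>{1..r}. W_summand0 (2 * l)))"

definition W_pos :: "nat \<Rightarrow> 'a"
  where "W_pos k = (let r = k div 2 in
    if k = 0 then w1
    else if odd k then
      w0 \<ominus> (\<Oplus>l\<in>{0..r}. W_summand1 (2 * l + 1)) \<ominus> (\<Oplus>l\<in>{1..r}. W_summand0 (2 * l))
    else
      w1 \<ominus> (\<Oplus>l\<in>{0..r - 1}. W_summand0 (2 * l + 1)) \<ominus> (\<Oplus>l\<in>{1..r}. W_summand1 (2 * l)))"

definition G :: "nat \<Rightarrow> 'a"
  where "G k = G_tilde (k + 1) \<oplus> (q + inverse q) \<odot> commutator M w1 (W_neg k)"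

end


section \<open>The $q$-Onsager algebra and the universal Askey-Wilson algebra\<close>

datatype onsager_gen = Gen_W0 | Gen_W1

text \<open>The two sides of the defining relation
  $[x,[x,[x,y]_q]_{q^{-1}}] = (q^2-q^{-2})^2 [y,x]$ are subtracted.\<close>

definition dolan_grady ::
  "('f::field, 'a, 'm) module_scheme \<Rightarrow> 'f \<Rightarrow> 'a \<Rightarrow> 'a \<Rightarrow> 'a"
  where "dolan_grady M q x y =
    commutator M x (q_commutator M (inverse q) x (q_commutator M q x y))
      \<ominus>\<^bsub>M\<^esub> (q ^ 2 - inverse q ^ 2) ^ 2 \<odot>\<^bsub>M\<^esub> commutator M y x"

definition onsager_relators :: "'f::field \<Rightarrow> (onsager_gen fword \<Rightarrow>\<^sub>0 'f) set"
  where "onsager_relators q =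
    {dolan_grady free_algebra q (free_gen Gen_W0) (free_gen Gen_W1),
     dolan_grady free_algebra q (free_gen Gen_W1) (free_gen Gen_W0)}"

definition q_onsager :: "'f::field \<Rightarrow> ('f, (onsager_gen fword \<Rightarrow>\<^sub>0 'f) set) module"
  where "q_onsager q = presented_algebra (onsager_relators q)"

definition onsager_W0 :: "'f::field \<Rightarrow> (onsager_gen fword \<Rightarrow>\<^sub>0 'f) set"
  where "onsager_W0 q = presented_gen (onsager_relators q) Gen_W0"

definition onsager_W1 :: "'f::field \<Rightarrow> (onsager_gen fword \<Rightarrow>\<^sub>0 'f) set"
  where "onsager_W1 q = presented_gen (onsager_relators q) Gen_W1"

datatype aw_gen = Gen_A | Gen_B | Gen_C

definition aw_central ::
  "('f::field, 'a, 'm) module_scheme \<Rightarrow> 'f \<Rightarrow> 'a \<Rightarrow> 'a \<Rightarrow> 'a \<Rightarrow> 'a"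
  where "aw_central M q x y z =
    x \<oplus>\<^bsub>M\<^esub> inverse (q ^ 2 - inverse q ^ 2) \<odot>\<^bsub>M\<^esub> q_commutator M q y z"

definition aw_relators :: "'f::field \<Rightarrow> (aw_gen fword \<Rightarrow>\<^sub>0 'f) set"
  where "aw_relators q =
    {commutator free_algebra z x | z x.
      z \<in> {aw_central free_algebra q (free_gen Gen_A) (free_gen Gen_B) (free_gen Gen_C),
           aw_central free_algebra q (free_gen Gen_B) (free_gen Gen_C) (free_gen Gen_A),
           aw_central free_algebra q (free_gen Gen_C) (free_gen Gen_A) (free_gen Gen_B)}}"

definition universal_AW :: "'f::field \<Rightarrow> ('f, (aw_gen fword \<Rightarrow>\<^sub>0 'f) set) module"
  where "universal_AW q = presented_algebra (aw_relators q)"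

definition AW_A :: "'f::field \<Rightarrow> (aw_gen fword \<Rightarrow>\<^sub>0 'f) set"
  where "AW_A q = presented_gen (aw_relators q) Gen_A"

definition AW_B :: "'f::field \<Rightarrow> (aw_gen fword \<Rightarrow>\<^sub>0 'f) set"
  where "AW_B q = presented_gen (aw_relators q) Gen_B"

end

theory Submission
  imports "HOL-Computational_Algebra.Formal_Power_Series" Defs
begin

text \<open>
  Put $D(t) = 1 + tC + t^2$ and let $X(t)$ be the generating function of the $B_{n\delta+\alpha_1}$.
  The recursion for these elements gives that $X(t) D(qt)$ and $D(q^{-1}t) X(t)$ are of the form
  $B - q^{\pm 2} t A$ plus a central series. Hence $D(q^{-1}t) B(t) D(qt)$ is
  a cubic polynomial in $A, B, C$, and it turns out to be a central series $N(t)$ built from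
  $\alpha, \beta, \gamma$ and the Casimir element.
  As $1 + tC/(q+q^{-1})$ becomes $D(ct)/(1+c^2t^2)$ when $(q+q^{-1})/(ct + c^{-1}t^{-1})$ is
  substituted for $t$, the $q$-expansion of $B(t)^\vee$ is $z(t)(1 + tC/(q+q^{-1}))$ with $z(t)$ central. Consequently every
  $W_{-k}$ is $z_k A$ plus a central element, every $W_{k+1}$ is $z_k B$ plus a central element, and
  $\tilde G_{k+1}$ and $G_{k+1}$ are $z_k C'$ and $z_k C''$ plus one and the same central element.
  The relations reduce to relations between $A$, $B$, $C'$, $C''$.
\<close>

section \<open>Central elements and the Askey-Wilson relations\<close>

text \<open>Why the factors D stand on two sides: the convolution in the definition of B(t) puts
  X(t)^2 into it, and one factor on the left and one on the right give each copy of X(t) a neighbour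
  that cuts its noncentral part down to two terms. Why D exists: up to a central term,
  \<open>B_delta1\<close> is a scalar multiple of C, so the recursion behind X(t) iterates the
  bracket with C, and this bracket commutes with multiplication by C on either side. The central
  series z(t) is itself a q-expansion, namely that of N(t) divided by (1 + q^2 t^2)(1 + q^-2 t^2).
  The obstacle is one of form. Rewriting and power series work over ring types, while O_q and
  Delta_q live on carrier sets. All named elements are formulas in two elements, and homomorphisms
  respect these formulas, the q-expansion included because its recursion has one solution. So the
  relations are proved in a ring type that has a homomorphism to Delta_q and are pushed forward; the
  same transport leads from O_q to Delta_q.\<close>

definition central :: "'a::monoid_mult \<Rightarrow> bool"
  where "central z \<longleftrightarrow> (\<forall>x. x * z = z * x)"

lemma centralD: "central z \<Longrightarrow> x * z = z * x"
  by (simp add: central_def)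

lemma central_left_commute: "central z \<Longrightarrow> x * (z * y) = z * (x * y)"
  by (metis central_def mult.assoc)

text \<open>Here q and its inverse are central ring elements Q and R, and the relations are cleared
  of the denominator q^2 - q^-2. In this form the locale is inherited by constant power series
  (\<open>aw_triple_fps\<close>), and only ring operations occur.\<close>

locale aw_triple =
  fixes Q R A B C al be ga :: "'a::ring_1"
  assumes QR: "Q * R = 1" and cQ: "central Q" and cR: "central R"
    and cal: "central al" and cbe: "central be" and cga: "central ga"
    and rel_al: "Q * (B * C) - R * (C * B) = (Q * Q - R * R) * (al - A)"
    and rel_be: "Q * (C * A) - R * (A * C) = (Q * Q - R * R) * (be - B)"
    and rel_ga: "Q * (A * B) - R * (B * A) = (Q * Q - R * R) * (ga - C)"
begin

lemma RQ: "R * Q = 1"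
  using QR cQ by (simp add: central_def)

lemma QRx: "Q * (R * x) = x" and RQx: "R * (Q * x) = x"
  by (simp_all add: QR RQ mult.assoc[symmetric])

text \<open>\<open>BA\<close>, \<open>CB\<close> and \<open>CA\<close> are the defining relations
  solved for the out-of-order products. Used as rewrite rules they straighten every word to the
  order A, B, C, which decides identities by comparing normal forms.\<close>

lemma BA: "B * A = Q * (Q * (A * B)) - Q * (Q * (Q * ga)) + R * ga + Q * (Q * (Q * C)) - R * C"
proof -
  have "B * A = Q * (R * (B * A))" by (simp add: QRx)
  also have "R * (B * A) = Q * (A * B) - (Q * Q - R * R) * (ga - C)"
    using rel_ga by (simp add: algebra_simps)
  finally show ?thesis by (simp add: algebra_simps QRx)
qed

lemma CB: "C * B = Q * (Q * (B * C)) - Q * (Q * (Q * al)) + R * al + Q * (Q * (Q * A)) - R * A"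
proof -
  have "C * B = Q * (R * (C * B))" by (simp add: QRx)
  also have "R * (C * B) = Q * (B * C) - (Q * Q - R * R) * (al - A)"
    using rel_al by (simp add: algebra_simps)
  finally show ?thesis by (simp add: algebra_simps QRx)
qed

lemma CA: "C * A = R * (R * (A * C)) + Q * be - R * (R * (R * be)) - Q * B + R * (R * (R * B))"
proof -
  have "C * A = R * (Q * (C * A))" by (simp add: RQx)
  also have "Q * (C * A) = R * (A * C) + (Q * Q - R * R) * (be - B)"
    using rel_be by (simp add: algebra_simps)
  finally show ?thesis by (simp add: algebra_simps RQx)
qed

text \<open>In right-nested products the out-of-order pair sits inside \<open>x * (y * w)\<close>;
  this lifts each straightening rule to that position.\<close>

lemma left_rewrite: "x * y = z \<Longrightarrow> x * (y * w) = z * w" for x y z w :: 'a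
  by (simp add: mult.assoc[symmetric])

lemmas PBW = QR RQ QRx RQx BA CB CA BA[THEN left_rewrite] CB[THEN left_rewrite] CA[THEN left_rewrite]

text \<open>Only instances that lead to the order Q, R, al, be, ga and then A, B, C: the
  unrestricted commutation rule would loop on two central factors.\<close>

lemmas sort_central =
  cQ[THEN centralD, of A] cQ[THEN centralD, of B] cQ[THEN centralD, of C]
  cQ[THEN centralD, of al] cQ[THEN centralD, of be] cQ[THEN centralD, of ga]
  cR[THEN centralD, of A] cR[THEN centralD, of B] cR[THEN centralD, of C]
  cR[THEN centralD, of al] cR[THEN centralD, of be] cR[THEN centralD, of ga]
  cal[THEN centralD, of A] cal[THEN centralD, of B] cal[THEN centralD, of C]
  cal[THEN centralD, of be] cal[THEN centralD, of ga]
  cbe[THEN centralD, of A] cbe[THEN centralD, of B] cbe[THEN centralD, of C]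
  cbe[THEN centralD, of ga]
  cga[THEN centralD, of A] cga[THEN centralD, of B] cga[THEN centralD, of C]
  cQ[THEN central_left_commute, of A] cQ[THEN central_left_commute, of B] cQ[THEN central_left_commute, of C]
  cQ[THEN central_left_commute, of al] cQ[THEN central_left_commute, of be] cQ[THEN central_left_commute, of ga]
  cR[THEN central_left_commute, of A] cR[THEN central_left_commute, of B] cR[THEN central_left_commute, of C]
  cR[THEN central_left_commute, of al] cR[THEN central_left_commute, of be] cR[THEN central_left_commute, of ga]
  cal[THEN central_left_commute, of A] cal[THEN central_left_commute, of B] cal[THEN central_left_commute, of C]
  cal[THEN central_left_commute, of be] cal[THEN central_left_commute, of ga]
  cbe[THEN central_left_commute, of A] cbe[THEN central_left_commute, of B] cbe[THEN central_left_commute, of C]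
  cbe[THEN central_left_commute, of ga]
  cga[THEN central_left_commute, of A] cga[THEN central_left_commute, of B] cga[THEN central_left_commute, of C]

text \<open>The Casimir element qABC + q^2 A^2 + q^-2 B^2 + q^2 C^2 - qA alpha - q^-1 B beta - qC
  gamma in its usual form, where alpha, beta, gamma are q + q^-1 times al, be, ga. This explains the
  factors \<open>Q * Q + 1\<close> and \<open>1 + R * R\<close>.\<close>

definition Casimir :: 'a
  where "Casimir = Q * (A * (B * C)) + Q * (Q * (A * A)) + R * (R * (B * B)) + Q * (Q * (C * C))
    - (Q * Q + 1) * (al * A) - (1 + R * R) * (be * B) - (Q * Q + 1) * (ga * C)"

text \<open>This is as far as the relations alone lead. Centrality also needs that A, B, C generate
  the ring, and enters \<open>aw_algebra\<close> as an assumption.\<close>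

lemma Casimir_commute: "A * Casimir = Casimir * A" "B * Casimir = Casimir * B"
    "C * Casimir = Casimir * C"
  unfolding Casimir_def
  by (simp_all add: algebra_simps sort_central PBW)

text \<open>The left-hand side is D(q^-1 t) B(t) D(qt) with B(t) expressed through X(t):
  \<open>DL\<close> and \<open>DR\<close> are the two factors, \<open>YL\<close> stands for D(q^-1
  t) X(t) and \<open>YR\<close> for X(t) D(qt), and \<open>e\<close> collects the central parts of
  these products. N is the value that the straightened expression turns out to have.\<close>

lemma conjugated_delta_identity:
  fixes t e :: 'a
  assumes t: "central t" and e: "central e" and te: "e = t * (t * e) + (Q + R) * (t * (al + t * be))"
  defines "DL \<equiv> 1 + R * (t * C) + R * (R * (t * t))"
    and "DR \<equiv> 1 + Q * (t * C) + Q * (Q * (t * t))"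
    and "YL \<equiv> B - R * (R * (t * A)) + R * e"
    and "YR \<equiv> B - Q * (Q * (t * A)) + Q * e"
    and "N \<equiv> 1 + (Q + R) * (t * ga) + t * (t * (Q * Q + R * R - Casimir)) + (Q + R) * (t * (t * (e * be)))
      + t * (t * (e * e)) + (Q + R) * (t * (t * (t * ga))) + t * (t * (t * t))"
  shows "(R * R - 1) * (DL * DR + t * (t * (YL * YR))) + t * (R * R * (YL * A * DR) - DL * (A * YR))
    = (R * R - 1) * N"
proof -
  note sort = 
    t[THEN centralD, of A] t[THEN centralD, of B] t[THEN centralD, of C]
    t[THEN centralD, of Q] t[THEN centralD, of R] t[THEN centralD, of al] t[THEN centralD, of be] t[THEN centralD, of ga]
    t[THEN centralD, of e]
    t[THEN central_left_commute, of A] t[THEN central_left_commute, of B] t[THEN central_left_commute, of C]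
    t[THEN central_left_commute, of Q] t[THEN central_left_commute, of R] t[THEN central_left_commute, of al] t[THEN central_left_commute, of be] t[THEN central_left_commute, of ga]
    t[THEN central_left_commute, of e]
    e[THEN centralD, of A] e[THEN centralD, of B] e[THEN centralD, of C]
    e[THEN centralD, of Q] e[THEN centralD, of R] e[THEN centralD, of al] e[THEN centralD, of be] e[THEN centralD, of ga]
    e[THEN central_left_commute, of A] e[THEN central_left_commute, of B] e[THEN central_left_commute, of C]
    e[THEN central_left_commute, of Q] e[THEN central_left_commute, of R] e[THEN central_left_commute, of al] e[THEN central_left_commute, of be] e[THEN central_left_commute, of ga]
  \<comment> \<open>For a free central e, straightening leaves a single noncentral remainder, a
    multiple of A. Its coefficient vanishes by the equation \<open>te\<close>.\<close>
  have "(R * R - 1) * (DL * DR + t * (t * (YL * YR))) + t * (R * R * (YL * A * DR) - DL * (A * YR))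
    = (R * R - 1) * N + (R * R * R - Q) * (t * ((e - (t * (t * e) + (Q + R) * (t * (al + t * be)))) * A))"
    unfolding Casimir_def DL_def DR_def YL_def YR_def N_def
    by (simp add: algebra_simps sort sort_central PBW)
  then show ?thesis
    using te by simp
qed
end

section \<open>Power series over a noncommutative ring\<close>

text \<open>The coefficient of $t^m$ in $(t/(1+t^2))^k$. For \<open>k = 0\<close> and \<open>m > 0\<close>
  the truncated subtraction in \<open>l + k - 1\<close> gives the binomial coefficient $\binom{l-1}{l} = 0$.\<close>

definition expansion_coeff :: "nat \<Rightarrow> nat \<Rightarrow> 'f::field"
  where "expansion_coeff m k = (if k \<le> m \<and> even (m - k)
    then (-1) ^ ((m - k) div 2) * of_nat (((m - k) div 2 + k - 1) choose ((m - k) div 2)) else 0)"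

text \<open>With u = t/(1 + t^2) this is (1 + t^2) u^(k+1) = t u^k read off in degree m + 2; on
  binomial coefficients it is Pascal's rule.\<close>

lemma expansion_coeff_rec:
  "expansion_coeff (Suc (Suc m)) (Suc k) + expansion_coeff m (Suc k)
    = (expansion_coeff (Suc m) k :: 'f::field)"
proof (cases "k \<le> Suc m \<and> even (Suc m - k)")
  case True
  then obtain l where l: "Suc m - k = 2 * l" by (blast elim: evenE)
  then have m: "Suc m = k + 2 * l" using True by simp
  show ?thesis
  proof (cases l)
    case 0
    then show ?thesis using m by (simp add: expansion_coeff_def)
  next
    case (Suc l')
    then have m': "m = Suc (k + 2 * l')" using m by simp
    have 1: "Suc (Suc m) - Suc k = 2 * Suc l'" "m - Suc k = 2 * l'" "Suc m - k = 2 * Suc l'"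
      using m' by simp_all
    show ?thesis
    proof (cases k)
      case 0
      then show ?thesis unfolding expansion_coeff_def 1 using m' by (simp add: binomial_eq_0)
    next
      case (Suc k')
      then show ?thesis unfolding expansion_coeff_def 1 using m' by (simp add: algebra_simps)
    qed
  qed
next
  case False
  then have "\<not> (Suc k \<le> Suc (Suc m) \<and> even (Suc (Suc m) - Suc k))" by simp
  moreover have "\<not> (Suc k \<le> m \<and> even (m - Suc k))"
  proof
    assume a: "Suc k \<le> m \<and> even (m - Suc k)"
    then have "Suc m - k = Suc (Suc (m - Suc k))" by linarith
    with a False show False by simp
  qed
  ultimately show ?thesis using False unfolding expansion_coeff_def by (simp only: if_False add_0)
qed

lemma expansion_coeff_self: "expansion_coeff m m = 1"
  by (simp add: expansion_coeff_def)

text \<open>Constant term 1 provides a one-sided inverse over any ring, so such factors cancel on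
  either side without commutativity.\<close>

lemma fps_cancel_left:
  fixes F G H :: "'a::ring_1 fps"
  assumes "H * F = H * G" "fps_nth H 0 = 1"
  shows "F = G"
proof -
  have "fps_left_inverse H 1 * H = 1" using assms(2) by (intro fps_left_inverse) simp
  then have "F = fps_left_inverse H 1 * (H * F)" by (simp flip: mult.assoc)
  also have "\<dots> = G" using \<open>fps_left_inverse H 1 * H = 1\<close> unfolding assms(1) by (simp flip: mult.assoc)
  finally show ?thesis .
qed

lemma fps_cancel_right:
  fixes F G H :: "'a::ring_1 fps"
  assumes "F * H = G * H" "fps_nth H 0 = 1"
  shows "F = G"
proof -
  have "H * fps_right_inverse H 1 = 1" using assms(2) by (intro fps_right_inverse) simp
  then have "F = F * H * fps_right_inverse H 1" by (simp add: mult.assoc)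
  also have "\<dots> = G" using \<open>H * fps_right_inverse H 1 = 1\<close> unfolding assms(1) by (simp add: mult.assoc)
  finally show ?thesis .
qed

section \<open>Central elements of the power series ring\<close>

lemma central_fps_X: "central (fps_X :: 'a::ring_1 fps)"
  by (simp add: central_def fps_mult_fps_X_commute)

lemma central_fpsI:
  assumes "\<And>n. central (fps_nth F n)" shows "central (F :: 'a::ring_1 fps)"
  unfolding central_def
proof (intro allI fps_ext)
  fix H n
  have "(\<Sum>i=0..n. fps_nth H i * fps_nth F (n - i)) = (\<Sum>i=0..n. fps_nth F (n - i) * fps_nth H i)"
    using assms by (simp add: central_def)
  also have "\<dots> = (\<Sum>i=0..n. fps_nth F i * fps_nth H (n - i))"
    by (rule sum.reindex_bij_witness[of _ "\<lambda>i. n - i" "\<lambda>i. n - i"]) auto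
  finally show "fps_nth (H * F) n = fps_nth (F * H) n" by (simp add: fps_mult_nth)
qed

lemma central_fps_nth:
  assumes "central (F :: 'a::ring_1 fps)" shows "central (fps_nth F n)"
  unfolding central_def
proof
  fix x
  have "fps_const x * F = F * fps_const x" using assms by (simp add: central_def)
  then have "fps_nth (fps_const x * F) n = fps_nth (F * fps_const x) n" by simp
  then show "x * fps_nth F n = fps_nth F n * x" by simp
qed

lemma central_closed:
  fixes x y :: "'a::ring_1"
  shows "central (0::'a)" "central (1::'a)"
    and "central x \<Longrightarrow> central y \<Longrightarrow> central (x + y)"
    and "central x \<Longrightarrow> central y \<Longrightarrow> central (x - y)"
    and "central x \<Longrightarrow> central (- x)"
    and "central x \<Longrightarrow> central y \<Longrightarrow> central (x * y)"
proof -
  assume x: "central x" and y: "central y"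
  show "central (x * y)" unfolding central_def
    by (metis centralD[OF x] centralD[OF y] mult.assoc)
qed (simp_all add: central_def algebra_simps)

lemma central_sum: "(\<And>i. i \<in> I \<Longrightarrow> central (f i)) \<Longrightarrow> central (sum f I :: 'a::ring_1)"
  by (induction I rule: infinite_finite_induct) (simp_all add: central_closed)

section \<open>Dilation of the variable\<close>

definition fps_dilate :: "'a::ring_1 \<Rightarrow> 'a fps \<Rightarrow> 'a fps"
  where "fps_dilate c F = Abs_fps (\<lambda>n. c ^ n * fps_nth F n)"

lemma fps_dilate_nth [simp]: "fps_nth (fps_dilate c F) n = c ^ n * fps_nth F n"
  by (simp add: fps_dilate_def)

lemma central_power: "central x \<Longrightarrow> central (x ^ n :: 'a::ring_1)"
  by (induction n) (simp_all add: central_closed)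

lemma fps_dilate_add: "fps_dilate c (F + H) = fps_dilate c F + fps_dilate c H"
  by (rule fps_ext) (simp add: algebra_simps)

lemma fps_dilate_diff: "fps_dilate c (F - H) = fps_dilate c F - fps_dilate c H"
  by (rule fps_ext) (simp add: algebra_simps)

lemma fps_dilate_mult:
  assumes "central c" shows "fps_dilate c (F * H) = fps_dilate c F * fps_dilate c H"
proof (rule fps_ext)
  fix n
  have "c ^ n * (fps_nth F i * fps_nth H (n - i)) =
      c ^ i * fps_nth F i * (c ^ (n - i) * fps_nth H (n - i))" if "i \<le> n" for i
  proof -
    have "c ^ n = c ^ i * c ^ (n - i)" using that by (simp flip: power_add)
    then show ?thesis
      using central_left_commute[OF central_power[OF assms], of "fps_nth F i" "n - i"]
      by (simp add: mult.assoc)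
  qed
  then show "fps_nth (fps_dilate c (F * H)) n = fps_nth (fps_dilate c F * fps_dilate c H) n"
    by (simp add: fps_mult_nth sum_distrib_left)
qed

lemma fps_dilate_const [simp]: "fps_dilate c (fps_const x) = fps_const x"
  by (rule fps_ext) (simp add: fps_const_def)

lemma fps_dilate_one [simp]: "fps_dilate c 1 = 1"
  by (rule fps_ext) simp

lemma fps_dilate_X [simp]: "fps_dilate c fps_X = fps_const c * fps_X"
  by (rule fps_ext) (simp add: fps_X_def)

lemma central_dilate: "central c \<Longrightarrow> central F \<Longrightarrow> central (fps_dilate c F)"
  by (intro central_fpsI) (simp add: central_closed central_power central_fps_nth)

text \<open>Scalar multiplication is encoded as multiplication by the image of a central ring
  homomorphism from the field, so that scalars take part in ring rewriting.\<close>

locale scalars =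
  fixes sc :: "'f::field \<Rightarrow> 'a::ring_1"
  assumes sc_1 [simp]: "sc 1 = 1"
    and sc_add: "sc (x + y) = sc x + sc y"
    and sc_mult: "sc (x * y) = sc x * sc y"
    and central_sc: "central (sc x)"
begin

lemma sc_0 [simp]: "sc 0 = 0"
  using sc_add[of 0 0] by simp

lemma sc_minus: "sc (- x) = - sc x"
  using sc_add[of x "- x"] by (simp add: eq_neg_iff_add_eq_0 add.commute)

lemma sc_diff: "sc (x - y) = sc x - sc y"
  using sc_add[of x "- y"] by (simp add: sc_minus)

lemma sc_power: "sc (x ^ n) = sc x ^ n"
  by (induction n) (simp_all add: sc_mult)

lemma sc_mult_cancel: "c \<noteq> 0 \<Longrightarrow> sc c * x = sc c * y \<longleftrightarrow> x = y"
  by (metis left_inverse mult.assoc mult_1 sc_1 sc_mult)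

text \<open>The ring type viewed as a carrier-based algebra, so that \<open>q_expansion\<close>,
  \<open>G_tilde\<close> and the other given notions can be evaluated in it.\<close>

definition alg :: "('f, 'a) module"
  where "alg = \<lparr>carrier = UNIV, mult = (*), one = 1, zero = 0, add = (+), smult = (\<lambda>c x. sc c * x)\<rparr>"

lemma alg_simps [simp]:
  "carrier alg = UNIV" "mult alg = (*)" "one alg = 1" "zero alg = 0" "add alg = (+)"
  "c \<odot>\<^bsub>alg\<^esub> x = sc c * x"
  by (simp_all add: alg_def)

lemma ring_alg: "ring alg"
proof (rule ringI)
  show "abelian_group alg"
  proof (rule abelian_groupI)
    fix x show "\<exists>y\<in>carrier alg. y \<oplus>\<^bsub>alg\<^esub> x = \<zero>\<^bsub>alg\<^esub>"
      by (auto intro: exI[of _ "- x"])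
  qed (simp_all add: add.assoc add.commute)
  show "Group.monoid alg"
    by (rule monoidI) (simp_all add: mult.assoc)
qed (simp_all add: distrib_left distrib_right)

lemma sc_left_commute: "x * (sc c * y) = sc c * (x * y)"
  by (rule central_left_commute[OF central_sc])

sublocale alg: f_algebra alg
proof (intro f_algebra.intro f_algebra_axioms.intro ring_alg)
  show "x \<otimes>\<^bsub>alg\<^esub> (c \<odot>\<^bsub>alg\<^esub> y) = c \<odot>\<^bsub>alg\<^esub> (x \<otimes>\<^bsub>alg\<^esub> y)" for x y c
    by (simp add: sc_left_commute)
qed (simp_all add: sc_add sc_mult distrib_left distrib_right mult.assoc)

lemma alg_uminus [simp]: "\<ominus>\<^bsub>alg\<^esub> x = - x"
  by (rule alg.minus_equality) simp_all

lemma alg_minus [simp]: "x \<ominus>\<^bsub>alg\<^esub> y = x - y"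
  by (simp add: a_minus_def)

lemma alg_finsum [simp]: "finite I \<Longrightarrow> finsum alg f I = sum f I"
  by (induction I rule: finite_induct) (simp_all add: alg.finsum_insert)

lemma commutator_alg [simp]: "commutator alg x y = x * y - y * x"
  by (simp add: commutator_def)

lemma q_commutator_alg [simp]:
  "q_commutator alg q x y = sc q * (x * y) - sc (inverse q) * (y * x)"
  by (simp add: q_commutator_def)

text \<open>Substitution of $w/(t+t^{-1})$ for the variable.\<close>

definition expansion_subst :: "'f \<Rightarrow> 'a fps \<Rightarrow> 'a fps"
  where "expansion_subst w F = Abs_fps (\<lambda>m. \<Sum>k\<le>m. sc (expansion_coeff m k * w ^ k) * fps_nth F k)"

text \<open>\<open>expansion_coeff m k\<close> vanishes for k > m, so coefficients of different
  degrees can be written as sums over one common range and compared term by term.\<close>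

lemma expansion_subst_nth:
  assumes "m \<le> n"
  shows "fps_nth (expansion_subst w F) m = (\<Sum>k\<le>n. sc (expansion_coeff m k * w ^ k) * fps_nth F k)"
  unfolding expansion_subst_def fps_nth_Abs_fps using assms
  by (intro sum.mono_neutral_left) (auto simp: expansion_coeff_def)

lemma expansion_subst_add:
  "expansion_subst w (F + H) = expansion_subst w F + expansion_subst w H"
  by (rule fps_ext) (simp add: expansion_subst_def algebra_simps sum.distrib)

lemma expansion_subst_diff:
  "expansion_subst w (F - H) = expansion_subst w F - expansion_subst w H"
  by (rule fps_ext) (simp add: expansion_subst_def algebra_simps sum_subtractf)

lemma expansion_subst_mult_const:
  "expansion_subst w (F * fps_const x) = expansion_subst w F * fps_const x"
  by (rule fps_ext) (simp add: expansion_subst_def mult.assoc sum_distrib_right)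

lemma central_expansion_subst: "central F \<Longrightarrow> central (expansion_subst w F)"
  by (intro central_fpsI)
    (simp add: expansion_subst_def central_sum central_closed central_sc central_fps_nth)

lemma expansion_subst_0: "fps_nth (expansion_subst w F) 0 = fps_nth F 0"
  by (simp add: expansion_subst_def expansion_coeff_self)

text \<open>The variable becomes wt/(1 + t^2). Cleared of the denominator, this is
  \<open>expansion_coeff_rec\<close> in every degree from 2 on; degrees 0 and 1 are checked by
  hand.\<close>

lemma expansion_subst_X_mult:
  "(1 + fps_X * fps_X) * expansion_subst w (fps_X * F) = fps_const (sc w) * (fps_X * expansion_subst w F)"
proof (rule fps_ext)
  fix n
  let ?c = "\<lambda>m k. sc (expansion_coeff m k * w ^ k)"
  have step: "sc a * x + sc b * x = sc w * (sc c * x)" if "a + b = w * c" for a b c x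
    using that by (simp add: sc_add[symmetric] sc_mult[symmetric] flip: distrib_right mult.assoc)
  have [simp]: "fps_nth ((1 + fps_X * fps_X) * H) (Suc (Suc m)) = fps_nth H (Suc (Suc m)) + fps_nth H m"
    for H :: "'a fps" and m
    by (simp add: distrib_right mult.assoc)
  consider "n = 0" | "n = 1" | m where "n = Suc (Suc m)" by (metis One_nat_def not0_implies_Suc)
  then show "fps_nth ((1 + fps_X * fps_X) * expansion_subst w (fps_X * F)) n =
      fps_nth (fps_const (sc w) * (fps_X * expansion_subst w F)) n"
  proof cases
    case 3
    have m: "m \<le> Suc (Suc m)" by simp
    have "fps_nth (expansion_subst w (fps_X * F)) n + fps_nth (expansion_subst w (fps_X * F)) m
        = (\<Sum>k\<le>Suc m. ?c (Suc (Suc m)) (Suc k) * fps_nth F k) + (\<Sum>k\<le>Suc m. ?c m (Suc k) * fps_nth F k)"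
      unfolding 3 expansion_subst_nth[OF le_refl[of "Suc (Suc m)"]] expansion_subst_nth[OF m]
      by (simp only: sum.atMost_Suc_shift[of _ "Suc m"] fps_X_mult_nth) simp
    also have "\<dots> = (\<Sum>k\<le>Suc m. sc w * (?c (Suc m) k * fps_nth F k))"
      unfolding sum.distrib[symmetric]
    proof (intro sum.cong refl step)
      fix k
      have "expansion_coeff (Suc (Suc m)) (Suc k) * w ^ Suc k + expansion_coeff m (Suc k) * w ^ Suc k
          = expansion_coeff (Suc m) k * w ^ Suc k"
        by (simp only: distrib_right[symmetric] expansion_coeff_rec)
      then show "expansion_coeff (Suc (Suc m)) (Suc k) * w ^ Suc k + expansion_coeff m (Suc k) * w ^ Suc k
          = w * (expansion_coeff (Suc m) k * w ^ k)"
        by (simp add: mult_ac)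
    qed
    also have "\<dots> = sc w * fps_nth (expansion_subst w F) (Suc m)"
      unfolding expansion_subst_nth[OF le_refl] by (simp only: sum_distrib_left)
    finally show ?thesis by (simp add: 3)
  next
    case 1
    then show ?thesis by (simp add: expansion_subst_0)
  next
    case 2
    then show ?thesis
      by (simp add: distrib_right mult.assoc expansion_subst_def expansion_coeff_def)
  qed
qed

end

section \<open>The $q$-expansion as a functional equation\<close>

lemma inverse_square_neq_1:
  fixes q :: "'f::field"
  assumes "q \<noteq> 0" "\<forall>n>0. q ^ n \<noteq> 1" shows "inverse q ^ 2 \<noteq> 1"
proof
  assume "inverse q ^ 2 = 1"
  then have "q ^ 2 = 1" using assms(1) by (simp add: power_inverse)
  then show False using assms(2) by auto
qed

locale q_scalars = scalars sc for sc :: "'f::field \<Rightarrow> 'a::ring_1" +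
  fixes q :: 'f
  assumes q_nonzero: "q \<noteq> 0" and q_not_root: "\<forall>n>0. q ^ n \<noteq> 1"
begin

lemma q_power_neq: "n > 0 \<Longrightarrow> q ^ n \<noteq> inverse q ^ n"
  using qint_nonzero[OF q_nonzero q_not_root, of n] by (auto simp: qint_def)

lemma q_diff_nonzero: "q - inverse q \<noteq> 0"
  using q_power_neq[of 1] by simp

lemma sc_mult_mult: "sc c * x * (sc d * y) = sc (c * d) * (x * y)"
  by (simp only: sc_mult mult.assoc sc_left_commute[of x])

definition q_subst :: "'a fps \<Rightarrow> 'a fps"
  where "q_subst = expansion_subst (qint q 2)"

text \<open>If $a(t) f(qt) f(q^{-1}t) = 1$ with $f(t) = b([2]_q/(t+t^{-1}))$, then comparing this at $qt$ and
  at $q^{-1}t$ gives $a(qt) f(q^2t) = a(q^{-1}t) f(q^{-2}t)$. This is linear in \<open>b\<close>, and its coefficients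
  are the defining recursion of the $q$-expansion.\<close>

definition q_dilate :: "'f \<Rightarrow> 'a fps \<Rightarrow> 'a fps \<Rightarrow> 'a fps"
  where "q_dilate c F H = fps_dilate (sc c) F * fps_dilate (sc (c ^ 2)) (q_subst H)"

text \<open>The exponent 2n - i consists of i from F(ct) and 2(n - i) from the series in c^2 t. This
  is the origin of [2n - j] in the recursion.\<close>

lemma q_dilate_nth:
  "fps_nth (q_dilate c F H) n
    = (\<Sum>i\<le>n. sc (c ^ (2 * n - i)) * (fps_nth F i * fps_nth (q_subst H) (n - i)))"
  unfolding q_dilate_def fps_mult_nth atMost_atLeast0
proof (rule sum.cong[OF refl])
  fix i assume "i \<in> {0..n}"
  then have "2 * n - i = i + 2 * (n - i)" by simp
  then have "c ^ (2 * n - i) = c ^ i * (c ^ 2) ^ (n - i)"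
    by (simp only: power_add power_mult)
  then show "fps_nth (fps_dilate (sc c) F) i * fps_nth (fps_dilate (sc (c ^ 2)) (q_subst H)) (n - i) =
      sc (c ^ (2 * n - i)) * (fps_nth F i * fps_nth (q_subst H) (n - i))"
    unfolding fps_dilate_nth sc_power[symmetric] by (simp only: sc_mult_mult)
qed

lemma q_dilate_diff_nth:
  "fps_nth (q_dilate q F H - q_dilate (inverse q) F H) n
    = sc (q - inverse q) * (\<Sum>i\<le>n. sc (qint q (2 * n - i)) * (fps_nth F i * fps_nth (q_subst H) (n - i)))"
proof -
  have "sc (q ^ m) * x - sc (inverse q ^ m) * x = sc (q - inverse q) * (sc (qint q m) * x)" for m x
  proof -
    have "sc (q - inverse q) * (sc (qint q m) * x) = sc ((q - inverse q) * qint q m) * x"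
      by (simp add: sc_mult mult.assoc)
    also have "(q - inverse q) * qint q m = q ^ m - inverse q ^ m"
      using q_diff_nonzero by (simp add: qint_def)
    finally show ?thesis by (simp add: sc_diff left_diff_distrib)
  qed
  then show ?thesis
    by (simp add: q_dilate_nth sum_distrib_left flip: sum_subtractf)
qed

text \<open>The index i = n contributes [n] a_n because b_0 = 1. For i < n the substituted series
  has positive degree, so only coefficients of b with positive index occur, written as k +
  1.\<close>

lemma q_expansion_sum:
  assumes n: "n \<ge> 1" and b0: "b 0 = 1"
  shows "(\<Sum>i\<le>n. sc (qint q (2 * n - i)) * (a i * fps_nth (q_subst (Abs_fps b)) (n - i)))
    = sc (qint q n) * a n +
      (\<Sum>(j, k, l)\<in>{(j, k, l). j + k + 2 * l + 1 = n}.
        sc ((-1) ^ l * of_nat ((k + l) choose l) * qint q (2 * n - j) * qint q 2 ^ (k + 1))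
          * (a j * b (k + 1)))"
proof -
  let ?g = "\<lambda>(j, k). sc (qint q (2 * n - j))
    * (a j * (sc (expansion_coeff (n - j) (Suc k) * qint q 2 ^ Suc k) * b (Suc k)))"
  have "(\<Sum>i\<le>n. sc (qint q (2 * n - i)) * (a i * fps_nth (q_subst (Abs_fps b)) (n - i)))
    = (\<Sum>i<n. sc (qint q (2 * n - i)) * (a i * fps_nth (q_subst (Abs_fps b)) (n - i)))
      + sc (qint q n) * a n"
    using b0 by (simp add: q_subst_def expansion_subst_0 flip: lessThan_Suc_atMost)
  also have "(\<Sum>i<n. sc (qint q (2 * n - i)) * (a i * fps_nth (q_subst (Abs_fps b)) (n - i)))
    = (\<Sum>j<n. \<Sum>k<n - j. ?g (j, k))"
  proof (rule sum.cong[OF refl])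
    fix j assume "j \<in> {..<n}"
    then obtain m where m: "n - j = Suc m" by (metis lessThan_iff Suc_diff_Suc)
    have "fps_nth (q_subst (Abs_fps b)) (n - j)
      = (\<Sum>k<n - j. sc (expansion_coeff (n - j) (Suc k) * qint q 2 ^ Suc k) * b (Suc k))"
      unfolding q_subst_def expansion_subst_def m fps_nth_Abs_fps sum.atMost_Suc_shift lessThan_Suc_atMost
      by (simp add: expansion_coeff_def binomial_eq_0)
    then show "sc (qint q (2 * n - j)) * (a j * fps_nth (q_subst (Abs_fps b)) (n - j)) = (\<Sum>k<n - j. ?g (j, k))"
      by (simp only: sum_distrib_left prod.case)
  qed
  also have "\<dots> = sum ?g (SIGMA j:{..<n}. {..<n - j})"
    by (subst sum.Sigma) auto
  \<comment> \<open>These are the pairs for which n - j - (k + 1) is an even number 2l; for the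
    others the expansion coefficient is zero. The bijection below recovers l from j and k.\<close>
  also have "\<dots> = sum ?g {(j, k). j < n \<and> k < n - j \<and> odd (n - j - k)}"
  proof (rule sum.mono_neutral_right)
    show "\<forall>x\<in>(SIGMA j:{..<n}. {..<n - j}) - {(j, k). j < n \<and> k < n - j \<and> odd (n - j - k)}. ?g x = 0"
    proof
      fix x assume "x \<in> (SIGMA j:{..<n}. {..<n - j}) - {(j, k). j < n \<and> k < n - j \<and> odd (n - j - k)}"
      then obtain j k where x: "x = (j, k)" "k < n - j" "even (n - j - k)" by auto
      moreover have "n - j - k = Suc (n - j - Suc k)" using x(2) by linarith
      ultimately have "odd (n - j - Suc k)" by (metis even_Suc)
      then have "expansion_coeff (n - j) (Suc k) = (0 :: 'f)"
        by (simp only: expansion_coeff_def if_False simp_thms)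
      then show "?g x = 0" by (simp add: x(1))
    qed
  qed auto
  also have "\<dots> = (\<Sum>(j, k, l)\<in>{(j, k, l). j + k + 2 * l + 1 = n}.
        sc ((-1) ^ l * of_nat ((k + l) choose l) * qint q (2 * n - j) * qint q 2 ^ (k + 1))
          * (a j * b (k + 1)))"
  proof (rule sum.reindex_bij_witness
      [where i = "\<lambda>(j, k, l). (j, k)" and j = "\<lambda>(j, k). (j, k, (n - j - k) div 2)"])
    fix x assume "x \<in> {(j, k). j < n \<and> k < n - j \<and> odd (n - j - k)}"
    then obtain j k where x: "x = (j, k)" "j < n" "k < n - j" "odd (n - j - k)" by auto
    then obtain l where l: "n - j - k = 2 * l + 1" by (blast elim: oddE)
    have l': "(n - j - k) div 2 = l" unfolding l by simp
    have l'': "n - j - Suc k = 2 * l" "n = j + k + 2 * l + 1"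
      using l x(2,3) by linarith+
    show "(case case x of (j, k) \<Rightarrow> (j, k, (n - j - k) div 2) of (j, k, l) \<Rightarrow>
        sc ((-1) ^ l * of_nat ((k + l) choose l) * qint q (2 * n - j) * qint q 2 ^ (k + 1))
          * (a j * b (k + 1))) = ?g x"
    proof -
      have "sc c * (y * (sc d * z)) = sc (c * d) * (y * z)" for c d y z
        by (simp only: sc_left_commute[of y] sc_mult mult.assoc)
      moreover have "expansion_coeff (n - j) (Suc k) = (-1) ^ l * (of_nat ((k + l) choose l) :: 'f)"
        using x(2,3) l'' by (simp add: expansion_coeff_def add.commute)
      ultimately show ?thesis
        unfolding x(1) prod.case l' by (simp only: Suc_eq_plus1 mult_ac)
    qed
    show "(case x of (j, k) \<Rightarrow> (j, k, (n - j - k) div 2)) \<in> {(j, k, l). j + k + 2 * l + 1 = n}"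
      using l'' by (simp add: x(1) l')
    show "(case case x of (j, k) \<Rightarrow> (j, k, (n - j - k) div 2) of (j, k, l) \<Rightarrow> (j, k)) = x"
      by (simp add: x(1))
  qed auto
  finally show ?thesis by (simp add: add.commute)
qed

text \<open>Both series agree in degree 0 because [0] = 0, so the recursion for n >= 1 amounts to an
  equality of whole series.\<close>

lemma is_q_expansion_alg:
  assumes a0: "a 0 = 1"
  shows "is_q_expansion alg q a b \<longleftrightarrow> range b \<subseteq> generated_subalgebra alg (range a) \<and> b 0 = 1 \<and>
    q_dilate q (Abs_fps a) (Abs_fps b) = q_dilate (inverse q) (Abs_fps a) (Abs_fps b)"
proof -
  have fin: "finite {(j, k, l). j + k + 2 * l + 1 = n}" for n :: nat
    by (rule finite_subset[of _ "{..n} \<times> {..n} \<times> {..n}"]) auto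
  let ?s = "\<lambda>n. \<Sum>i\<le>n. sc (qint q (2 * n - i)) * (a i * fps_nth (q_subst (Abs_fps b)) (n - i))"
  have "q_dilate q (Abs_fps a) (Abs_fps b) = q_dilate (inverse q) (Abs_fps a) (Abs_fps b)
    \<longleftrightarrow> (\<forall>n. sc (q - inverse q) * ?s n = sc (q - inverse q) * 0)"
  proof -
    have "q_dilate q (Abs_fps a) (Abs_fps b) = q_dilate (inverse q) (Abs_fps a) (Abs_fps b)
      \<longleftrightarrow> q_dilate q (Abs_fps a) (Abs_fps b) - q_dilate (inverse q) (Abs_fps a) (Abs_fps b) = 0"
      by simp
    then show ?thesis unfolding fps_eq_iff q_dilate_diff_nth by simp
  qed
  also have "\<dots> \<longleftrightarrow> (\<forall>n. ?s n = 0)"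
    by (simp only: sc_mult_cancel[OF q_diff_nonzero])
  also have "\<dots> \<longleftrightarrow> (\<forall>n\<ge>1. ?s n = 0)"
  proof -
    have "?s 0 = 0" by (simp add: qint_def)
    then show ?thesis by (metis not_less_eq_eq One_nat_def le0 le_antisym)
  qed
  finally have eq: "q_dilate q (Abs_fps a) (Abs_fps b) = q_dilate (inverse q) (Abs_fps a) (Abs_fps b)
    \<longleftrightarrow> (\<forall>n\<ge>1. ?s n = 0)" .
  show ?thesis
  proof (cases "b 0 = 1")
    case True
    show ?thesis
      unfolding is_q_expansion_def eq using True fin q_expansion_sum[where a = a and b = b, OF _ True]
      by (simp add: case_prod_unfold eq_commute[of 0])
  qed (simp add: is_q_expansion_def)
qed

text \<open>The equation is linear in H. Once the lower coefficients of the difference K vanish,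
  degree n reads [2n] [2]^n K_n = 0. The coefficients of H and H' may lie outside the subalgebra
  generated by those of F, which allows an explicitly written solution to be recognised as the
  q-expansion.\<close>

lemma q_expansion_unique:
  assumes F: "fps_nth F 0 = 1" and H: "fps_nth H 0 = fps_nth H' 0"
    and "q_dilate q F H = q_dilate (inverse q) F H"
    and "q_dilate q F H' = q_dilate (inverse q) F H'"
  shows "H = H'"
proof -
  define K where "K = H - H'"
  have K: "q_dilate q F K - q_dilate (inverse q) F K = 0"
    using assms(3,4)
    by (simp add: K_def q_dilate_def q_subst_def expansion_subst_diff fps_dilate_diff right_diff_distrib)
  have "fps_nth K n = 0" for n
  proof (induction n rule: less_induct)
    case (less n)
    have sub: "fps_nth (q_subst K) m = (if m = n then sc (qint q 2 ^ n) * fps_nth K n else 0)" if "m \<le> n" for m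
    proof -
      have "fps_nth (q_subst K) m = (\<Sum>k\<le>m. if k = n then sc (qint q 2 ^ n) * fps_nth K n else 0)"
        unfolding q_subst_def expansion_subst_def fps_nth_Abs_fps using that less
        by (intro sum.cong refl) (auto simp: expansion_coeff_self)
      then show ?thesis using that by simp
    qed
    show ?case
    proof (cases "n = 0")
      case True
      then show ?thesis using H by (simp add: K_def)
    next
      case False
      have "sc (q - inverse q) * (\<Sum>i\<le>n. sc (qint q (2 * n - i)) * (fps_nth F i * fps_nth (q_subst K) (n - i))) = 0"
        using q_dilate_diff_nth[of F K n] K by simp
      also have "(\<Sum>i\<le>n. sc (qint q (2 * n - i)) * (fps_nth F i * fps_nth (q_subst K) (n - i)))
        = (\<Sum>i\<le>n. if i = 0 then sc (qint q (2 * n)) * (sc (qint q 2 ^ n) * fps_nth K n) else 0)"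
        using sub F False by (intro sum.cong refl) (auto simp: sub)
      finally have "sc (q - inverse q) * (sc (qint q (2 * n)) * (sc (qint q 2 ^ n) * fps_nth K n)) = sc (q - inverse q) * (sc (qint q (2 * n)) * (sc (qint q 2 ^ n) * 0))"
        by simp
      moreover have nz: "qint q (2 * n) \<noteq> 0" "qint q 2 ^ n \<noteq> 0"
        using False qint_nonzero[OF q_nonzero q_not_root] by simp_all
      ultimately show ?thesis
        by (simp only: sc_mult_cancel[OF q_diff_nonzero] sc_mult_cancel[OF nz(1)] sc_mult_cancel[OF nz(2)])
    qed
  qed
  then have "K = 0" by (simp add: fps_eq_iff)
  then show ?thesis by (simp add: K_def)
qed

end

section \<open>Quadratic factors\<close>

lemma central_fps_const: "central (x :: 'a::ring_1) \<Longrightarrow> central (fps_const x)"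
  by (intro central_fpsI) (simp add: fps_const_def central_closed)

lemma central_left_inverse:
  fixes g p :: "'a::ring_1"
  assumes "g * p = 1" "central p" shows "central g"
  unfolding central_def
proof
  fix x
  have "x * g = g * (p * x) * g" using assms(1) by (simp flip: mult.assoc)
  also have "\<dots> = g * x * (p * g)" using central_left_commute[OF assms(2), of x] by (simp add: mult.assoc)
  also have "p * g = 1" using assms(1) centralD[OF assms(2), of g] by simp
  finally show "x * g = g * x" by simp
qed

context scalars
begin

abbreviation scX :: "'f \<Rightarrow> 'a fps" where "scX c \<equiv> fps_const (sc c)"

lemma central_scX: "central (scX c)"
  by (intro central_fps_const central_sc)

text \<open>This is D(st) of the overview with x in the place of C. Its special case
  \<open>quad0\<close>, with x = 0, is the denominator 1 + s^2 t^2 of the dilated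
  substitution.\<close>

definition quad :: "'f \<Rightarrow> 'a \<Rightarrow> 'a fps"
  where "quad s x = 1 + scX s * (fps_X * fps_const x) + scX (s ^ 2) * (fps_X * fps_X)"

lemma quad_nth_0 [simp]: "fps_nth (quad s x) 0 = 1"
  by (simp add: quad_def)

lemma quad_commute:
  assumes "H * fps_const x = fps_const x * H" shows "H * quad s x = quad s x * H"
  unfolding quad_def
  by (simp add: distrib_left distrib_right mult.assoc central_left_commute[OF central_scX, of H]
      central_left_commute[OF central_fps_X, of H] centralD[OF central_fps_X, of H] assms)

lemma quad_commute_const: "fps_const x * quad s x = quad s x * fps_const x"
  by (rule quad_commute) simp

lemma quad_commute_quad: "quad r x * quad s x = quad s x * quad r x"
  by (rule quad_commute) (simp add: quad_commute_const)

lemma dilate_quad: "fps_dilate (sc c) (quad s x) = quad (c * s) x"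
proof -
  have merge: "scX r * (scX d * F) = scX (r * d) * F" for r d F
    by (simp add: sc_mult flip: mult.assoc)
  show ?thesis
    unfolding quad_def fps_dilate_add fps_dilate_mult[OF central_sc] fps_dilate_const fps_dilate_one
      fps_dilate_X
    by (simp only: mult.assoc central_left_commute[OF central_scX, of fps_X] merge)
      (simp only: power2_eq_square mult_ac)
qed

definition quad0 :: "'f \<Rightarrow> 'a fps"
  where "quad0 s = quad s 0"

lemma central_quad0: "central (quad0 s)"
  unfolding quad0_def quad_def
  by (intro central_closed central_scX central_fps_X central_fps_const)

lemma quad0_nth_0 [simp]: "fps_nth (quad0 s) 0 = 1"
  by (simp add: quad0_def)

lemma dilate_quad0: "fps_dilate (sc c) (quad0 s) = quad0 (c * s)"
  by (simp add: quad0_def dilate_quad)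

text \<open>Central elements form a subalgebra. Together with the membership clause of
  \<open>is_q_expansion\<close> this makes the q-expansion of a central series central.\<close>

lemma generated_central:
  assumes "\<And>x. x \<in> S \<Longrightarrow> central x" "y \<in> generated_subalgebra alg S" shows "central y"
proof -
  have "subring {x. central x} alg"
    by (rule alg.subringI) (auto intro: central_closed)
  moreover have "sc c * x \<in> {x. central x}" if "x \<in> {x. central x}" for c x
    using that by (auto intro: central_closed central_sc)
  ultimately show ?thesis
    using assms unfolding generated_subalgebra_def by fastforce
qed

end

context q_scalars
begin

text \<open>The factor k = 1/[2] undoes the [2] brought in by the substitution, so that 1 + ktx
  becomes 1 + tx/(1 + t^2), which is D(t)/(1 + t^2).\<close>

lemma q_subst_linear:
  assumes w: "qint q 2 * k = 1"
  shows "quad0 1 * q_subst (H + scX k * (fps_X * (H * fps_const x))) = q_subst H * quad 1 x"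
proof -
  have "q_subst (scX k * (fps_X * (H * fps_const x))) = scX k * (q_subst (fps_X * H) * fps_const x)"
  proof -
    have "scX k * (fps_X * (H * fps_const x)) = fps_X * H * fps_const (sc k * x)"
      by (simp add: mult.assoc central_left_commute[OF central_scX, of H]
          central_left_commute[OF central_scX, of fps_X] flip: fps_const_mult)
    also have "q_subst \<dots> = q_subst (fps_X * H) * fps_const (sc k * x)"
      by (simp add: q_subst_def expansion_subst_mult_const)
    also have "\<dots> = scX k * (q_subst (fps_X * H) * fps_const x)"
      by (simp add: central_left_commute[OF central_scX] flip: fps_const_mult)
    finally show ?thesis .
  qed
  moreover have "quad0 1 * q_subst (fps_X * H) = scX (qint q 2) * (fps_X * q_subst H)"
    using expansion_subst_X_mult[of "qint q 2" H] by (simp add: q_subst_def quad0_def quad_def)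
  moreover have "scX k * scX (qint q 2) = 1"
    using w by (simp add: mult.commute flip: sc_mult)
  moreover have "quad0 1 * (scX k * (q_subst (fps_X * H) * fps_const x))
      = scX k * (quad0 1 * q_subst (fps_X * H) * fps_const x)"
    by (simp only: central_left_commute[OF central_scX, of "quad0 1"] mult.assoc)
  ultimately have "quad0 1 * q_subst (scX k * (fps_X * (H * fps_const x))) = fps_X * (q_subst H * fps_const x)"
    by (simp flip: mult.assoc)
  moreover have "q_subst H * quad 1 x = q_subst H * quad0 1 + fps_X * (q_subst H * fps_const x)"
    by (simp add: quad0_def quad_def distrib_left central_left_commute[OF central_fps_X])
  moreover have "quad0 1 * q_subst (H + scX k * (fps_X * (H * fps_const x)))
     = quad0 1 * q_subst H + quad0 1 * q_subst (scX k * (fps_X * (H * fps_const x)))"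
    by (simp add: q_subst_def expansion_subst_add distrib_left)
  ultimately show ?thesis
    using centralD[OF central_quad0, of "q_subst H" 1] by simp
qed

lemma ex1_q_expansion_alg: "a 0 = 1 \<Longrightarrow> \<exists>!b. is_q_expansion alg q a b"
  by (rule alg.ex1_q_expansion[OF q_nonzero q_not_root]) simp_all

text \<open>Since a(t) is M(t) divided by D(q^-1 t) D(qt), and D(ct)/(1 + c^2 t^2) is the image of 1
  + tx/[2], the q-expansion of a(t) has the factor 1 + tx/[2]. The other factor is the q-expansion z
  of what remains, M(t) divided by the product of the two denominators.\<close>

lemma q_expansion_quad:
  assumes a0: "a 0 = 1" and M: "central M"
    and aM: "quad (inverse q) x * Abs_fps a * quad q x = M"
  obtains z where "\<And>n. central (z n)" "z 0 = 1"
    "q_expansion alg q a 0 = 1"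
    "\<And>n. q_expansion alg q a (Suc n) = z (Suc n) + sc (inverse (qint q 2)) * (z n * x)"
proof -
  let ?A = "Abs_fps a" and ?qi = "inverse q"
  let ?D = "\<lambda>s. quad s x"
  \<comment> \<open>M commutes with D(q^-1 t). Writing out M on both sides and cancelling the outer
    factors shows that a(t) commutes with D(q^-1 t), so both quadratic factors can be collected on
    the right.\<close>
  have "?D ?qi * (?A * ?D ?qi) * ?D q = M * ?D ?qi"
    unfolding aM[symmetric] by (simp only: mult.assoc quad_commute_quad[of ?qi x q])
  also have "\<dots> = ?D ?qi * M"
    using centralD[OF M, of "?D ?qi"] by simp
  also have "\<dots> = ?D ?qi * (?D ?qi * ?A) * ?D q"
    unfolding aM[symmetric] by (simp only: mult.assoc)
  finally have "?D ?qi * (?A * ?D ?qi) = ?D ?qi * (?D ?qi * ?A)"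
    by (rule fps_cancel_right) simp
  then have comm: "?A * ?D ?qi = ?D ?qi * ?A"
    by (rule fps_cancel_left) simp
  have AM: "?A * (?D ?qi * ?D q) = M" using aM comm by (simp flip: mult.assoc)
  define P where "P = quad0 ?qi * quad0 q"
  have cP: "central P" unfolding P_def by (intro central_closed central_quad0)
  have P0: "fps_nth P 0 = 1" by (simp add: P_def)
  define g where "g = fps_left_inverse P 1"
  have gP: "g * P = 1" unfolding g_def using P0 by (intro fps_left_inverse) simp
  have cg: "central g" using gP cP by (rule central_left_inverse)
  define N where "N = M * g"
  have cN: "central N" unfolding N_def by (intro central_closed M cg)
  have NP: "N * P = M" using gP by (simp add: N_def mult.assoc)
  have "fps_nth M 0 = 1" using aM[symmetric] a0 by simp
  then have N0: "fps_nth N 0 = 1" using arg_cong[OF NP, of "\<lambda>F. fps_nth F 0"] P0 by simp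
  obtain z where z: "is_q_expansion alg q (fps_nth N) z"
    using ex1_implies_ex[OF ex1_q_expansion_alg[where a = "fps_nth N", OF N0]] by blast
  note z' = z[unfolded is_q_expansion_alg[where a = "fps_nth N", OF N0]]
  have cz: "central (z n)" for n
  proof (rule generated_central[of "range (fps_nth N)"])
    show "z n \<in> generated_subalgebra alg (range (fps_nth N))" using z' by blast
  qed (use central_fps_nth[OF cN] in blast)
  define Z where "Z = Abs_fps z"
  have cZ: "central Z" unfolding Z_def using cz by (intro central_fpsI) simp
  have Zeq: "q_dilate q N Z = q_dilate ?qi N Z" using z' by (simp add: Z_def fps_nth_inverse)
  define k where "k = inverse (qint q 2)"
  have wk: "qint q 2 * k = 1"
    unfolding k_def using qint_nonzero[OF q_nonzero q_not_root, of 2] by simp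
  define Bf where "Bf = Z + scX k * (fps_X * (Z * fps_const x))"
  have cU: "central (fps_dilate (sc c) (q_subst Z))" for c
    unfolding q_subst_def by (intro central_dilate central_sc central_expansion_subst cZ)
  \<comment> \<open>For either value of c the numbers c q^-1 and c q are 1 and c^2 in some order.
    The factors at c^2 are absorbed by the substitution in \<open>Bf\<close>; those at 1 are the
    same for both values of c, so they cancel when the two equations are compared.\<close>
  have step: "q_dilate c ?A Bf * ?D 1 = q_dilate c N Z * quad0 1" if c: "c = q \<or> c = ?qi" for c
  proof -
    let ?Ac = "fps_dilate (sc c) ?A" and ?U = "fps_dilate (sc (c ^ 2)) (q_subst Z)"
      and ?V = "fps_dilate (sc (c ^ 2)) (q_subst Bf)" and ?Nc = "fps_dilate (sc c) N"
    have "fps_dilate (sc c) (?A * (?D ?qi * ?D q)) = fps_dilate (sc c) (N * (quad0 ?qi * quad0 q))"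
      using AM NP by (simp add: P_def)
    then have 1: "?Ac * (?D (c * ?qi) * ?D (c * q)) = ?Nc * (quad0 (c * ?qi) * quad0 (c * q))"
      by (simp only: fps_dilate_mult[OF central_sc] dilate_quad dilate_quad0)
    have 2: "?Ac * (?D (c ^ 2) * ?D 1) = ?Nc * (quad0 (c ^ 2) * quad0 1)"
      using c
    proof
      assume "c = q"
      then show ?thesis using 1 q_nonzero
        by (simp add: power2_eq_square quad_commute_quad[of 1 x "q * q"]
           centralD[OF central_quad0, of "quad0 1" "q * q"])
    next
      assume "c = ?qi"
      then show ?thesis using 1 q_nonzero by (simp add: power2_eq_square)
    qed
    have "fps_dilate (sc (c ^ 2)) (quad0 1 * q_subst Bf) = fps_dilate (sc (c ^ 2)) (q_subst Z * ?D 1)"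
      unfolding Bf_def using q_subst_linear[OF wk] by simp
    then have 3: "quad0 (c ^ 2) * ?V = ?U * ?D (c ^ 2)"
      by (simp add: fps_dilate_mult[OF central_sc] dilate_quad dilate_quad0)
    have "quad0 (c ^ 2) * (q_dilate c ?A Bf * ?D 1) = ?Ac * (quad0 (c ^ 2) * ?V) * ?D 1"
      by (simp add: q_dilate_def mult.assoc central_left_commute[OF central_quad0, of ?Ac])
    also have "\<dots> = ?U * (?Ac * (?D (c ^ 2) * ?D 1))"
      unfolding 3 by (simp add: mult.assoc central_left_commute[OF cU, of ?Ac])
    also have "\<dots> = quad0 (c ^ 2) * (q_dilate c N Z * quad0 1)"
      unfolding 2 by (simp add: q_dilate_def mult.assoc centralD[OF cU, of ?Nc] 
          central_left_commute[OF central_quad0, of ?Nc] central_left_commute[OF central_quad0, of ?U])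
    finally show ?thesis by (rule fps_cancel_left) simp
  qed
  have eq: "q_dilate q ?A Bf = q_dilate ?qi ?A Bf"
  proof (rule fps_cancel_right)
    show "q_dilate q ?A Bf * ?D 1 = q_dilate ?qi ?A Bf * ?D 1"
      by (simp only: step simp_thms Zeq)
  qed simp
  obtain b where b: "is_q_expansion alg q a b"
    using ex1_implies_ex[OF ex1_q_expansion_alg[where a = a, OF a0]] by blast
  note b' = b[unfolded is_q_expansion_alg[where a = a, OF a0]]
  \<comment> \<open>\<open>Bf\<close> solves the functional equation with the right constant term,
    hence is the q-expansion.\<close>
  have "Abs_fps b = Bf"
  proof (rule q_expansion_unique)
    show "fps_nth ?A 0 = 1" using a0 by simp
    show "fps_nth (Abs_fps b) 0 = fps_nth Bf 0" using b' z' by (simp add: Bf_def Z_def)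
    show "q_dilate q ?A (Abs_fps b) = q_dilate ?qi ?A (Abs_fps b)" using b' by blast
  qed (rule eq)
  then have b_nth: "b n = fps_nth Bf n" for n by (metis fps_nth_Abs_fps)
  have "q_expansion alg q a = b"
    unfolding q_expansion_def
    by (rule the_equality[where P = "is_q_expansion alg q a", OF b]) (use ex1_q_expansion_alg[where a = a, OF a0] b in blast)
  then have "q_expansion alg q a 0 = 1"
    "\<And>n. q_expansion alg q a (Suc n) = z (Suc n) + sc (inverse (qint q 2)) * (z n * x)"
    using b' by (simp_all add: b_nth Bf_def Z_def k_def)
  moreover have "z 0 = 1" using z' by blast
  ultimately show ?thesis using that cz by blast
qed

end

section \<open>The series $B(t)$ in an Askey-Wilson algebra\<close>

lemma (in aw_triple) aw_triple_fps:
  "aw_triple (fps_const Q) (fps_const R) (fps_const A) (fps_const B) (fps_const C)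
    (fps_const al) (fps_const be) (fps_const ga)"
  by unfold_locales (simp_all add: QR cQ cR cal cbe cga rel_al rel_be rel_ga central_fps_const)

declare B_alpha1.simps [simp del]

locale aw_algebra = q_scalars sc q + aw_triple "sc q" "sc (inverse q)" A B C al be ga
  for sc :: "'f::field \<Rightarrow> 'a::ring_1" and q A B C al be ga +
  assumes central_Casimir: "central Casimir"
begin

section \<open>The bracket with C and the recursion for X(t)\<close>

abbreviation Q :: 'a where "Q \<equiv> sc q"
abbreviation R :: 'a where "R \<equiv> sc (inverse q)"

text \<open>The bracket with \<open>B_delta1\<close> in the recursion of \<open>B_alpha1\<close>,
  rescaled: \<open>B_delta1\<close> is q^-1 (q^2 - q^-2) C plus a central element, and
  \<open>B_coeff\<close> reduces that scalar to 1/(q - q^-1).\<close>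

definition ad :: "'a \<Rightarrow> 'a"
  where "ad x = sc (inverse (q - inverse q)) * (C * x - x * C)"

lemma ad_diff: "ad (x - y) = ad x - ad y"
  by (simp add: ad_def algebra_simps)

lemma ad_add: "ad (x + y) = ad x + ad y"
  by (simp add: ad_def algebra_simps)

lemma ad_sc: "ad (sc c * x) = sc c * ad x"
  unfolding ad_def
  by (metis (no_types, lifting) mult.assoc right_diff_distrib sc_left_commute)

lemma ad_mult_C: "ad (x * C) = ad x * C"
  by (simp add: ad_def algebra_simps)

lemma ad_central: "central x \<Longrightarrow> ad x = 0"
  by (simp add: ad_def central_def)

lemma adI: "C * x - x * C = (Q - R) * y \<Longrightarrow> ad x = y"
  unfolding ad_def using q_diff_nonzero
  by (simp flip: mult.assoc sc_diff sc_mult)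

lemma ad_B: "ad B = Q * (B * C) - (Q * Q + 1) * (al - A)"
  by (rule adI) (simp add: algebra_simps PBW)

lemma ad_A: "ad A = (R * R + 1) * (be - B) - R * (A * C)"
  by (rule adI) (simp add: algebra_simps PBW)

abbreviation X :: "nat \<Rightarrow> 'a" where "X \<equiv> B_alpha1 alg q A B"

lemma B_delta1_eq: "B_delta1 alg q A B = R * ((Q * Q - R * R) * (C - ga))"
proof -
  have "B_delta1 alg q A B = R * (R * (B * A)) - A * B"
    by (simp add: B_delta1_def power2_eq_square sc_mult mult.assoc)
  then show ?thesis by (simp add: algebra_simps PBW)
qed

lemma ad_B_delta1:
  "sc (B_coeff q) * (B_delta1 alg q A B * x - x * B_delta1 alg q A B) = ad x"
proof -
  have "B_delta1 alg q A B * x - x * B_delta1 alg q A B = R * (Q * Q - R * R) * (C * x - x * C)"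
    unfolding B_delta1_eq
    by (simp add: algebra_simps sc_left_commute[of x] centralD[OF cga, of x])
  also have "R * (Q * Q - R * R) = sc (inverse q * (q ^ 2 - inverse q ^ 2))"
    by (simp add: sc_mult sc_diff power2_eq_square)
  also have "sc (B_coeff q) * (\<dots> * (C * x - x * C)) = sc (B_coeff q * (inverse q * (q ^ 2 - inverse q ^ 2))) * (C * x - x * C)"
    by (simp add: sc_mult mult.assoc)
  also have "B_coeff q * (inverse q * (q ^ 2 - inverse q ^ 2)) = inverse (q - inverse q)"
    using q_nonzero q_power_neq[of 2] by (simp add: B_coeff_def divide_simps)
  finally show ?thesis by (simp add: ad_def)
qed

lemma X_simps: "X 0 = B" "X (Suc 0) = A - ad B" "X (Suc (Suc n)) = X n - ad (X (Suc n))"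
  by (simp_all add: B_alpha1.simps ad_B_delta1)

text \<open>The central right-hand side of the three-term relations below. It has period two: since
  \<open>ad\<close> kills it, the recursion of \<open>alpha1_ext\<close> merely reproduces it two
  steps later.\<close>

definition tail :: "nat \<Rightarrow> 'a"
  where "tail n = (Q + R) * (if odd n then al else be)"

lemma central_tail: "central (tail n)"
  by (auto simp: tail_def intro!: central_closed central_sc cal cbe)

text \<open>Prepending \<open>A\<close> as $B_{-\delta+\alpha_1}$ makes the recursion hold from the start.\<close>

fun alpha1_ext :: "nat \<Rightarrow> 'a"
  where "alpha1_ext 0 = A" | "alpha1_ext (Suc n) = X n"

lemma alpha1_ext_rec: "alpha1_ext (Suc (Suc n)) = alpha1_ext n - ad (alpha1_ext (Suc n))"
  by (cases n) (simp_all only: alpha1_ext.simps X_simps)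

lemma ad_sc_central: "central x \<Longrightarrow> ad (sc c * x) = 0"
  by (simp add: ad_sc ad_central)

text \<open>\<open>ad\<close> commutes with multiplication by \<open>C\<close>, so the left-hand side obeys the recursion of
  \<open>alpha1_ext\<close>; as \<open>ad\<close> kills central elements, two initial values suffice.\<close>

lemma alpha1_ext_right: "alpha1_ext (Suc (Suc n)) + Q * (alpha1_ext (Suc n) * C) + Q * (Q * alpha1_ext n) = Q * tail (Suc n)"
proof (induction n rule: induct_nat_012)
  case 0
  show ?case
    by (simp add: X_simps ad_B tail_def algebra_simps PBW)
next
  case 1
  show ?case
    by (simp add: X_simps ad_B ad_A ad_diff ad_add ad_sc ad_mult_C ad_central cal tail_def algebra_simps PBW
        sort_central)
next
  case (ge2 n)
  have "(x - ad x') + Q * ((y - ad y') * C) + Q * (Q * (z - ad z'))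
      = (x + Q * (y * C) + Q * (Q * z)) - ad (x' + Q * (y' * C) + Q * (Q * z'))" for x x' y y' z z'
    by (simp add: ad_diff ad_add ad_sc ad_mult_C algebra_simps)
  then show ?case
    using ge2 ad_sc_central[OF central_tail]
    by (simp only: alpha1_ext_rec[of "Suc (Suc n)"] alpha1_ext_rec[of "Suc n"] alpha1_ext_rec[of n]) (simp add: tail_def)
qed

text \<open>Mirror image of the preceding relation: left multiplication by C commutes with
  \<open>ad\<close> too, and R takes the place of Q.\<close>

lemma alpha1_ext_left: "alpha1_ext (Suc (Suc n)) + R * (C * alpha1_ext (Suc n)) + R * (R * alpha1_ext n) = R * tail (Suc n)"
proof (induction n rule: induct_nat_012)
  case 0
  show ?case
    by (simp add: X_simps ad_B tail_def algebra_simps PBW)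
next
  case 1
  show ?case
    by (simp add: X_simps ad_B ad_A ad_diff ad_add ad_sc ad_mult_C ad_central cal tail_def algebra_simps PBW
        sort_central)
next
  case (ge2 n)
  have "ad (C * y) = C * ad y" for y
    by (simp add: ad_def algebra_simps sc_left_commute[of C])
  then have "(x - ad x') + R * (C * (y - ad y')) + R * (R * (z - ad z'))
      = (x + R * (C * y) + R * (R * z)) - ad (x' + R * (C * y') + R * (R * z'))" for x x' y y' z z'
    by (simp add: ad_diff ad_add ad_sc algebra_simps)
  then show ?case
    using ge2 ad_sc_central[OF central_tail]
    by (simp only: alpha1_ext_rec[of "Suc (Suc n)"] alpha1_ext_rec[of "Suc n"] alpha1_ext_rec[of n]) (simp add: tail_def)
qed

section \<open>Generating functions and the central series N(t)\<close>

abbreviation t :: "'a fps" where "t \<equiv> fps_X"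

definition tails :: "'a fps"
  where "tails = Abs_fps (\<lambda>n. if n = 0 then 0 else tail n)"

lemma central_tails: "central tails"
  by (intro central_fpsI) (simp add: tails_def central_tail central_closed)

lemma fps_cases_012:
  assumes "fps_nth F 0 = fps_nth H 0" "fps_nth F 1 = fps_nth H 1"
    "\<And>n. fps_nth F (Suc (Suc n)) = fps_nth H (Suc (Suc n))"
  shows "F = (H :: 'a fps)"
proof (rule fps_ext)
  fix n
  consider "n = 0" | "n = 1" | m where "n = Suc (Suc m)" by (metis One_nat_def not0_implies_Suc)
  then show "fps_nth F n = fps_nth H n" using assms by cases simp_all
qed

text \<open>Period two sums the series to (q + q^-1) t (al + t be)/(1 - t^2). This is the series e
  of \<open>conjugated_delta_identity\<close>.\<close>

lemma tails_eq:
  "tails = t * (t * tails) + (scX q + scX (inverse q)) * (t * (fps_const al + t * fps_const be))"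
  by (rule fps_cases_012)
    (simp_all add: tails_def tail_def algebra_simps mult.assoc)

definition alpha1_series :: "'a fps" where "alpha1_series = Abs_fps X"

text \<open>The three-term relation annihilates all noncentral parts from degree 2 on. In degree 1
  the prepended A is no coefficient of the series, so it survives as the boundary term in
  \<open>t * fps_const A\<close>.\<close>

lemma alpha1_series_right: "alpha1_series * quad q C = fps_const B - scX q * (scX q * (t * fps_const A)) + scX q * tails"
proof -
  have "alpha1_series * quad q C = alpha1_series + scX q * (t * (alpha1_series * fps_const C)) + scX (q ^ 2) * (t * (t * alpha1_series))"
    unfolding quad_def
    by (simp add: distrib_left central_left_commute[OF central_scX, of alpha1_series]
      central_left_commute[OF central_fps_X, of alpha1_series] centralD[OF central_fps_X, of alpha1_series])
  also have "\<dots> = fps_const B - scX q * (scX q * (t * fps_const A)) + scX q * tails"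
    using alpha1_ext_right[of 0] alpha1_ext_right[of "Suc n" for n]
    by (intro fps_cases_012)
      (simp_all add: alpha1_series_def tails_def X_simps(1) eq_diff_eq power2_eq_square sc_mult mult.assoc)
  finally show ?thesis .
qed

lemma alpha1_series_left: "quad (inverse q) C * alpha1_series = fps_const B - scX (inverse q) * (scX (inverse q) * (t * fps_const A)) + scX (inverse q) * tails"
proof -
  have "quad (inverse q) C * alpha1_series = alpha1_series + scX (inverse q) * (t * (fps_const C * alpha1_series)) + scX (inverse q ^ 2) * (t * (t * alpha1_series))"
    unfolding quad_def by (simp add: distrib_right mult.assoc)
  also have "\<dots> = fps_const B - scX (inverse q) * (scX (inverse q) * (t * fps_const A)) + scX (inverse q) * tails"
    using alpha1_ext_left[of 0] alpha1_ext_left[of "Suc n" for n]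
    by (intro fps_cases_012)
      (simp_all add: alpha1_series_def tails_def X_simps(1) eq_diff_eq power2_eq_square sc_mult mult.assoc)
  finally show ?thesis .
qed

definition delta_series :: "'a fps" where "delta_series = Abs_fps (B_delta alg q A B)"

text \<open>The products with A carry an index shift by one and the convolution a shift by two,
  whence t and t^2. The separately defined coefficients of degree 0 and 1 fit the same
  formula.\<close>

lemma delta_series_eq:
  "delta_series = (scX (inverse q) * scX (inverse q) - 1) * (1 + t * (t * (alpha1_series * alpha1_series)))
    + t * (scX (inverse q) * scX (inverse q) * (alpha1_series * fps_const A) - fps_const A * alpha1_series)"
proof (rule fps_cases_012)
  fix m
  show "fps_nth delta_series (Suc (Suc m)) =
    fps_nth ((scX (inverse q) * scX (inverse q) - 1) * (1 + t * (t * (alpha1_series * alpha1_series)))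
      + t * (scX (inverse q) * scX (inverse q) * (alpha1_series * fps_const A) - fps_const A * alpha1_series)) (Suc (Suc m))"
    by (simp add: delta_series_def alpha1_series_def fps_mult_nth[of "Abs_fps X"] power2_eq_square sc_diff sc_mult
      left_diff_distrib mult.assoc)
qed (simp_all add: delta_series_def alpha1_series_def B_delta1_def X_simps(1) power2_eq_square sc_diff sc_mult left_diff_distrib
    mult.assoc)

interpretation fps: aw_triple "scX q" "scX (inverse q)" "fps_const A" "fps_const B" "fps_const C"
  "fps_const al" "fps_const be" "fps_const ga"
  by (rule aw_triple_fps)

lemma fps_Casimir: "fps.Casimir = fps_const Casimir"
  unfolding fps.Casimir_def Casimir_def by (simp flip: fps_const_1_eq_1)

definition norm_series :: "'a fps"
  where "norm_series = 1 + (scX q + scX (inverse q)) * (t * fps_const ga)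
    + t * (t * (scX q * scX q + scX (inverse q) * scX (inverse q) - fps_const Casimir))
    + (scX q + scX (inverse q)) * (t * (t * (tails * fps_const be))) + t * (t * (tails * tails))
    + (scX q + scX (inverse q)) * (t * (t * (t * fps_const ga))) + t * (t * (t * t))"

lemma central_norm_series: "central norm_series"
  unfolding norm_series_def
  by (intro central_closed central_scX central_fps_X central_tails central_fps_const cga cbe central_Casimir)

lemma quad_delta_series: "quad (inverse q) C * delta_series * quad q C = (scX (inverse q) * scX (inverse q) - 1) * norm_series"
proof -
  let ?DL = "quad (inverse q) C" and ?DR = "quad q C" and ?R = "scX (inverse q)" and ?A = "fps_const A"
  let ?k = "?R * ?R - 1"
  have k: "central ?k" by (intro central_closed central_scX)
  have RR: "central (?R * ?R)" by (intro central_closed central_scX)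
  note mv = central_left_commute[OF k, of ?DL] central_left_commute[OF RR, of ?DL]
    central_left_commute[OF central_fps_X, of ?DL]
  \<comment> \<open>Central factors are moved outwards until every copy of X(t) that has a quadratic
    factor within reach stands next to it; the one-sided formulas then replace these
    products.\<close>
  have "?DL * delta_series * ?DR = ?k * (?DL * ?DR + t * (t * ((?DL * alpha1_series) * (alpha1_series * ?DR))))
    + t * (?R * ?R * ((?DL * alpha1_series) * ?A * ?DR) - ?DL * (?A * (alpha1_series * ?DR)))"
  proof -
    have "?DL * (?k * (1 + t * (t * (alpha1_series * alpha1_series)))) * ?DR
      = ?k * (?DL * ?DR + t * (t * ((?DL * alpha1_series) * (alpha1_series * ?DR))))"
      by (simp only: mult.assoc mv) (simp only: distrib_left distrib_right mult.assoc mult_1 mult_1_right mv)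
    moreover have "?DL * (t * (?R * ?R * (alpha1_series * ?A) - ?A * alpha1_series)) * ?DR
      = t * (?R * ?R * ((?DL * alpha1_series) * ?A * ?DR) - ?DL * (?A * (alpha1_series * ?DR)))"
      by (simp only: mult.assoc right_diff_distrib left_diff_distrib mv
          central_left_commute[OF central_scX, of ?DL])
    ultimately show ?thesis
      unfolding delta_series_eq by (simp only: distrib_left distrib_right)
  qed
  also have "\<dots> = ?k * norm_series"
  proof -
    have quads: "?DL = 1 + ?R * (t * fps_const C) + ?R * (?R * (t * t))"
      "?DR = 1 + scX q * (t * fps_const C) + scX q * (scX q * (t * t))"
      by (simp_all add: quad_def power2_eq_square sc_mult flip: fps_const_mult mult.assoc)
    show ?thesis
      unfolding alpha1_series_left alpha1_series_right
      unfolding quads norm_series_def fps_Casimir[symmetric]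
      by (rule fps.conjugated_delta_identity[OF central_fps_X central_tails tails_eq])
  qed
  finally show ?thesis .
qed

lemma B_vee_0: "B_vee alg q A B 0 = 1"
  using inverse_square_neq_1[OF q_nonzero q_not_root] by (simp add: B_vee_def flip: sc_mult)

lemma quad_B_vee: "quad (inverse q) C * Abs_fps (B_vee alg q A B) * quad q C = norm_series"
proof -
  let ?c = "inverse (inverse q ^ 2 - 1)"
  have "Abs_fps (B_vee alg q A B) = scX ?c * delta_series"
    by (rule fps_ext) (simp add: B_vee_def delta_series_def)
  then have "quad (inverse q) C * Abs_fps (B_vee alg q A B) * quad q C
    = scX ?c * (quad (inverse q) C * delta_series * quad q C)"
    by (simp add: mult.assoc central_left_commute[OF central_scX, of "quad (inverse q) C"])
  also have "\<dots> = scX ?c * scX (inverse q ^ 2 - 1) * norm_series"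
  proof -
    have "scX (inverse q ^ 2 - 1) = scX (inverse q) * scX (inverse q) - 1"
      by (simp add: sc_diff sc_mult power2_eq_square flip: fps_const_1_eq_1)
    then show ?thesis unfolding quad_delta_series by (simp only: mult.assoc)
  qed
  also have "\<dots> = norm_series" using inverse_square_neq_1[OF q_nonzero q_not_root] by (simp flip: sc_mult)
  finally show ?thesis .
qed

text \<open>The shift matters: in degree n + 1 the coefficient of C is a scalar times z n, not z (n
  + 1). Hence the noncentral parts of all four families with the same k carry the same factor z
  k.\<close>

lemma G_tilde_central_form:
  "\<exists>z. (\<forall>n. central (z n)) \<and> z 0 = 1 \<and> (\<forall>n. G_tilde alg q A B (Suc n)
    = sc (- (q - inverse q) * qint q 2 ^ 2) * z (Suc n) - sc ((q - inverse q) * qint q 2) * (z n * C))"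
proof -
  obtain z where z: "\<And>n. central (z n)" "z 0 = 1" "q_expansion alg q (B_vee alg q A B) 0 = 1"
    "\<And>n. q_expansion alg q (B_vee alg q A B) (Suc n) = z (Suc n) + sc (inverse (qint q 2)) * (z n * C)"
    using q_expansion_quad[OF B_vee_0 central_norm_series quad_B_vee] by blast
  have "(- (q - inverse q) * qint q 2 ^ 2) * inverse (qint q 2) = - ((q - inverse q) * qint q 2)"
    using qint_nonzero[OF q_nonzero q_not_root, of 2] by (simp add: power2_eq_square field_simps)
  then have "sc (- (q - inverse q) * qint q 2 ^ 2) * (sc (inverse (qint q 2)) * y)
    = - (sc ((q - inverse q) * qint q 2) * y)" for y
    by (simp only: mult.assoc[symmetric] sc_mult[symmetric]) (simp add: sc_minus)
  then have "G_tilde alg q A B (Suc n)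
    = sc (- (q - inverse q) * qint q 2 ^ 2) * z (Suc n) - sc ((q - inverse q) * qint q 2) * (z n * C)" for n
    by (simp add: G_tilde_def distrib_left z(4))
  then show ?thesis using z(1,2) by blast
qed

end

section \<open>The alternating elements\<close>

text \<open>The conclusion as a property of an algebra and four sequences, ready for transport along
  homomorphisms; \<open>Gp k\<close> and \<open>Gt k\<close> have index k + 1.\<close>

definition alternating_relations ::
  "('f::field, 'a, 'm) module_scheme \<Rightarrow> 'f \<Rightarrow> (nat \<Rightarrow> 'a) \<Rightarrow> (nat \<Rightarrow> 'a) \<Rightarrow> (nat \<Rightarrow> 'a) \<Rightarrow> (nat \<Rightarrow> 'a) \<Rightarrow> bool"
  where "alternating_relations M q Wn Wp Gp Gt \<longleftrightarrow> (let \<rho> = - ((q ^ 2 - inverse q ^ 2) ^ 2) in \<forall>k l.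
    commutator M (Wn 0) (Wp k) = commutator M (Wn k) (Wp 0) \<and>
    commutator M (Wn k) (Wp 0) = inverse (q + inverse q) \<odot>\<^bsub>M\<^esub> (Gt k \<ominus>\<^bsub>M\<^esub> Gp k) \<and>
    q_commutator M q (Wn 0) (Gp k) = q_commutator M q (Gt k) (Wn 0) \<and>
    q_commutator M q (Gt k) (Wn 0) = \<rho> \<odot>\<^bsub>M\<^esub> Wn (k + 1) \<ominus>\<^bsub>M\<^esub> \<rho> \<odot>\<^bsub>M\<^esub> Wp k \<and>
    q_commutator M q (Gp k) (Wp 0) = q_commutator M q (Wp 0) (Gt k) \<and>
    q_commutator M q (Wp 0) (Gt k) = \<rho> \<odot>\<^bsub>M\<^esub> Wp (k + 1) \<ominus>\<^bsub>M\<^esub> \<rho> \<odot>\<^bsub>M\<^esub> Wn k \<and>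
    commutator M (Wn k) (Wn l) = \<zero>\<^bsub>M\<^esub> \<and>
    commutator M (Wp k) (Wp l) = \<zero>\<^bsub>M\<^esub> \<and>
    commutator M (Wn k) (Wp l) \<oplus>\<^bsub>M\<^esub> commutator M (Wp k) (Wn l) = \<zero>\<^bsub>M\<^esub> \<and>
    commutator M (Wn k) (Gp l) \<oplus>\<^bsub>M\<^esub> commutator M (Gp k) (Wn l) = \<zero>\<^bsub>M\<^esub> \<and>
    commutator M (Wn k) (Gt l) \<oplus>\<^bsub>M\<^esub> commutator M (Gt k) (Wn l) = \<zero>\<^bsub>M\<^esub> \<and>
    commutator M (Wp k) (Gp l) \<oplus>\<^bsub>M\<^esub> commutator M (Gp k) (Wp l) = \<zero>\<^bsub>M\<^esub> \<and>
    commutator M (Wp k) (Gt l) \<oplus>\<^bsub>M\<^esub> commutator M (Gt k) (Wp l) = \<zero>\<^bsub>M\<^esub> \<and>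
    commutator M (Gp k) (Gp l) = \<zero>\<^bsub>M\<^esub> \<and>
    commutator M (Gt k) (Gt l) = \<zero>\<^bsub>M\<^esub> \<and>
    commutator M (Gt k) (Gp l) \<oplus>\<^bsub>M\<^esub> commutator M (Gp k) (Gt l) = \<zero>\<^bsub>M\<^esub>)"

text \<open>The result depends on the central data only through \<open>z * z'\<close>. For z = z_k
  and z' = z_l this is symmetric in k and l, so exchanging the roles of x and y changes just the
  sign.\<close>

lemma commutator_pencil:
  fixes x y z z' p p' :: "'a::ring_1"
  assumes z: "central z" and z': "central z'" and p: "central p" and p': "central p'"
  shows "(z * x + p) * (z' * y + p') - (z' * y + p') * (z * x + p) = z * z' * (x * y - y * x)"
  by (simp add: algebra_simps centralD[OF z, of z'] centralD[OF z, of y] centralD[OF z', of x]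
      central_left_commute[OF z, of z'] central_left_commute[OF z, of y] central_left_commute[OF z', of x]
      centralD[OF p, of z'] centralD[OF p, of y] centralD[OF p', of z] centralD[OF p', of x] centralD[OF p, of p']
      central_left_commute[OF p, of z'] central_left_commute[OF p', of z])

context scalars
begin

text \<open>Passing from k to k + 1 exchanges the two families and subtracts one more summand. The
  three cases are the branches of the definitions.\<close>

lemma W_rec:
  shows W_neg_Suc: "W_neg alg q w0 w1 (Suc k) = W_pos alg q w0 w1 k - W_summand0 alg q w0 w1 (Suc k)" (is ?neg)
    and W_pos_Suc: "W_pos alg q w0 w1 (Suc k) = W_neg alg q w0 w1 k - W_summand1 alg q w0 w1 (Suc k)" (is ?pos)
proof -
  have "k = 0 \<or> (\<exists>r. k = 2 * r + 1) \<or> (\<exists>r. k = 2 * r + 2)" by presburger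
  then consider "k = 0" | r where "k = 2 * r + 1" | r where "k = 2 * r + 2" by blast
  then have "?neg \<and> ?pos"
  proof cases
    case 1
    show ?thesis unfolding 1 by (simp add: W_neg_def W_pos_def)
  next
    case (2 r)
    show ?thesis unfolding 2 by (simp add: W_neg_def W_pos_def Let_def algebra_simps)
  next
    case (3 r)
    show ?thesis unfolding 3 by (simp add: W_neg_def W_pos_def Let_def algebra_simps)
  qed
  then show ?neg ?pos by simp_all
qed

end

context aw_algebra
begin

lemma qint_2: "(q - inverse q) * qint q 2 = q ^ 2 - inverse q ^ 2"
  using q_diff_nonzero by (simp add: qint_def)

lemma w_nonzero: "q ^ 2 - inverse q ^ 2 \<noteq> 0"
  using q_power_neq[of 2] by simp

lemma alternating_relations_alg:
  "alternating_relations alg q (W_neg alg q A B) (W_pos alg q A B) (G alg q A B) (\<lambda>k. G_tilde alg q A B (k + 1))"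
proof -
  obtain z where z: "\<forall>n. central (z n)" "z 0 = 1" "\<forall>n. G_tilde alg q A B (Suc n)
      = sc (- (q - inverse q) * qint q 2 ^ 2) * z (Suc n) - sc ((q - inverse q) * qint q 2) * (z n * C)"
    using G_tilde_central_form by blast
  have cz: "central (z n)" for n using z(1) by blast
  note z0 = z(2) and Gt = z(3)[rule_format]
  define w where "w = q ^ 2 - inverse q ^ 2"
  have scw: "sc w = Q * Q - R * R" by (simp add: w_def sc_diff sc_mult power2_eq_square)
  define c0 where "c0 = - (q - inverse q) * qint q 2 ^ 2"
  \<comment> \<open>The constant term of the series of \<open>G_tilde\<close> is chosen so that this
    product is rho, which cancels the denominators in \<open>W_summand0\<close> and
    \<open>W_summand1\<close>.\<close>
  have c0: "c0 * (q - inverse q) = - (w * w)"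
    unfolding c0_def w_def qint_2[symmetric] by (simp add: power2_eq_square algebra_simps)
  have w: "w \<noteq> 0" using w_nonzero by (simp add: w_def)
  have Gt': "G_tilde alg q A B (Suc n) = sc c0 * z (Suc n) + z n * (- (sc w * C))" for n
    unfolding Gt qint_2 c0_def[symmetric] w_def[symmetric]
    by (simp add: sc_left_commute[of "z n"])
  have c0_sc: "sc c0 * (Q * y) - sc c0 * (R * y) = - (sc (w ^ 2) * y)" for y
  proof -
    have "sc c0 * (Q * y) - sc c0 * (R * y) = sc (c0 * (q - inverse q)) * y"
      by (simp add: sc_mult sc_diff left_diff_distrib right_diff_distrib mult.assoc)
    then show ?thesis unfolding c0 by (simp add: sc_minus power2_eq_square)
  qed
  have w_cancel: "sc (inverse (w ^ 2)) * (- (sc (w ^ 2) * x) - sc (w ^ 2) * y) = - x - y" for x y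
    using w by (simp add: right_diff_distrib flip: sc_mult mult.assoc)
  have zsc: "z n * (sc c * y) = sc c * (z n * y)" for n c y by (rule sc_left_commute)
  have rels: "Q * (C * A) - R * (A * C) = sc w * (be - B)" "Q * (B * C) - R * (C * B) = sc w * (al - A)"
    unfolding scw by (rule rel_be rel_al)+
  have move: "sc c * (z n * x) = z n * (sc c * x)" "A * (z n * x) = z n * (A * x)"
    "B * (z n * x) = z n * (B * x)" "A * z n = z n * A" "B * z n = z n * B" for c n x
    by (simp_all only: zsc central_left_commute[OF cz, of A] central_left_commute[OF cz, of B]
        centralD[OF cz, of A] centralD[OF cz, of B])
  \<comment> \<open>The central part of \<open>G_tilde\<close> yields the multiple of A; its C part
    is a q-commutator of C and A, which the defining relation turns into be - B.\<close>
  have S0: "W_summand0 alg q A B (Suc n) = - (z (Suc n) * A) - z n * (be - B)" for n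
  proof -
    have "Q * (G_tilde alg q A B (Suc n) * A) - R * (A * G_tilde alg q A B (Suc n))
      = (sc c0 * (Q * (z (Suc n) * A)) - sc c0 * (R * (z (Suc n) * A)))
        - sc w * (z n * (Q * (C * A) - R * (A * C)))"
      unfolding Gt'
      by (simp add: algebra_simps move sc_left_commute[of A] sc_left_commute[of Q c0] sc_left_commute[of R c0]
          sc_left_commute[of Q w] sc_left_commute[of R w])
    also have "\<dots> = - (sc (w ^ 2) * (z (Suc n) * A)) - sc (w ^ 2) * (z n * (be - B))"
      unfolding c0_sc rels by (simp only: zsc power2_eq_square sc_mult mult.assoc)
    finally show ?thesis
      unfolding W_summand0_def w_def[symmetric] q_commutator_alg alg_simps by (simp only: w_cancel)
  qed
  have S1: "W_summand1 alg q A B (Suc n) = - (z (Suc n) * B) - z n * (al - A)" for n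
  proof -
    have "Q * (B * G_tilde alg q A B (Suc n)) - R * (G_tilde alg q A B (Suc n) * B)
      = (sc c0 * (Q * (z (Suc n) * B)) - sc c0 * (R * (z (Suc n) * B)))
        - sc w * (z n * (Q * (B * C) - R * (C * B)))"
      unfolding Gt'
      by (simp add: algebra_simps move sc_left_commute[of B] sc_left_commute[of Q c0] sc_left_commute[of R c0]
          sc_left_commute[of Q w] sc_left_commute[of R w])
    also have "\<dots> = - (sc (w ^ 2) * (z (Suc n) * B)) - sc (w ^ 2) * (z n * (al - A))"
      unfolding c0_sc rels by (simp only: zsc power2_eq_square sc_mult mult.assoc)
    finally show ?thesis
      unfolding W_summand1_def w_def[symmetric] q_commutator_alg alg_simps by (simp only: w_cancel)
  qed
  define p where "p k = W_neg alg q A B k - z k * A" for k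
  define r where "r k = W_pos alg q A B k - z k * B" for k
  have "central (p k) \<and> central (r k)" for k
  proof (induction k)
    case 0
    then show ?case by (simp add: p_def r_def z0 W_neg_def W_pos_def central_closed)
  next
    case (Suc k)
    \<comment> \<open>The multiple of B in the new summand is exactly the noncentral part of
      \<open>W_pos k\<close>, and the two cancel; likewise with A and
      \<open>W_neg k\<close>.\<close>
    have "p (Suc k) = r k + z k * be" "r (Suc k) = p k + z k * al"
      by (simp_all add: p_def r_def W_rec S0 S1 algebra_simps)
    then show ?case using Suc by (simp add: central_closed cz cal cbe)
  qed
  then have cp: "central (p k)" and cr: "central (r k)" for k by auto
  have Wn: "W_neg alg q A B k = z k * A + p k" and Wp: "W_pos alg q A B k = z k * B + r k" for k
    by (simp_all add: p_def r_def)
  \<comment> \<open>\<open>H\<close> and \<open>- (sc w * C)\<close> are the C'' and C' of the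
    overview. Inserting the relation for ga gives H = qBA - q^-1 AB - w ga and -wC = qAB - q^-1 BA -
    w ga: they differ by an exchange of A and B. This is why \<open>HA\<close> and \<open>HB\<close>
    below have the q-commutators of C on the right, with the factors in the opposite order.\<close>
  define H where "H = (Q + R) * (B * A - A * B) - sc w * C"
  define g where "g k = sc c0 * z (Suc k)" for k
  have cg: "central (g k)" for k unfolding g_def by (intro central_closed central_sc cz)
  have Gt'': "G_tilde alg q A B (Suc n) = z n * (- (sc w * C)) + g n" for n
    by (simp add: Gt' g_def)
  have Gp: "G alg q A B n = z n * H + g n" for n
  proof -
    have "B * W_neg alg q A B n - W_neg alg q A B n * B = z n * (B * A - A * B)"
      unfolding Wn by (simp add: algebra_simps move centralD[OF cp, of B])
    then have "G alg q A B n = G_tilde alg q A B (Suc n) + sc (q + inverse q) * (z n * (B * A - A * B))"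
      by (simp only: G_def alg_simps commutator_alg Suc_eq_plus1)
    then show ?thesis
      by (simp add: Gt'' H_def sc_add algebra_simps zsc)
  qed
  have HA: "Q * (A * H) - R * (H * A) = - (sc w * (Q * (C * A) - R * (A * C)))"
    unfolding H_def scw by (simp add: algebra_simps PBW sort_central)
  have HB: "Q * (H * B) - R * (B * H) = - (sc w * (Q * (B * C) - R * (C * B)))"
    unfolding H_def scw by (simp add: algebra_simps PBW sort_central)
  have W0: "W_neg alg q A B 0 = A" "W_pos alg q A B 0 = B" by (simp_all add: W_neg_def W_pos_def)
  have nz: "q + inverse q \<noteq> 0"
  proof
    \<comment> \<open>It is a factor of q^2 - q^-2.\<close>
    assume "q + inverse q = 0"
    then have "(q - inverse q) * (q + inverse q) = 0" by simp
    then show False using w_nonzero by (simp add: power2_eq_square algebra_simps)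
  qed
  have qA: "Q * (A * (z n * x + g n)) - R * ((z n * x + g n) * A)
      = z n * (Q * (A * x) - R * (x * A)) + (Q * (g n * A) - R * (g n * A))"
    "Q * ((z n * x + g n) * A) - R * (A * (z n * x + g n))
      = z n * (Q * (x * A) - R * (A * x)) + (Q * (g n * A) - R * (g n * A))" for n x
    by (simp_all add: algebra_simps move centralD[OF cg, of A])
  have qB: "Q * (B * (z n * x + g n)) - R * ((z n * x + g n) * B)
      = z n * (Q * (B * x) - R * (x * B)) + (Q * (g n * B) - R * (g n * B))"
    "Q * ((z n * x + g n) * B) - R * (B * (z n * x + g n))
      = z n * (Q * (x * B) - R * (B * x)) + (Q * (g n * B) - R * (g n * B))" for n x
    by (simp_all add: algebra_simps move centralD[OF cg, of B])
  have r3: "Q * (A * G alg q A B k) - R * (G alg q A B k * A)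
      = Q * (G_tilde alg q A B (Suc k) * A) - R * (A * G_tilde alg q A B (Suc k))" for k
    unfolding Gp Gt'' qA HA by (simp add: algebra_simps sc_left_commute[of A] sc_left_commute[of Q w] sc_left_commute[of R w])
  have r5: "Q * (G alg q A B k * B) - R * (B * G alg q A B k)
      = Q * (B * G_tilde alg q A B (Suc k)) - R * (G_tilde alg q A B (Suc k) * B)" for k
    unfolding Gp Gt'' qB HB by (simp add: algebra_simps sc_left_commute[of B] sc_left_commute[of Q w] sc_left_commute[of R w])
  have r2: "W_neg alg q A B k * B - B * W_neg alg q A B k
      = sc (inverse (q + inverse q)) * (G_tilde alg q A B (Suc k) - G alg q A B k)" for k
    using nz by (simp add: G_def right_diff_distrib flip: sc_mult mult.assoc)
  have rho: "sc (- (w ^ 2)) * (x - sc (inverse (w ^ 2)) * y) - sc (- (w ^ 2)) * x = y" for x y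
    using w by (simp add: right_diff_distrib sc_minus flip: sc_mult mult.assoc)
  have r1: "A * W_pos alg q A B k - W_pos alg q A B k * A = W_neg alg q A B k * B - B * W_neg alg q A B k" for k
    unfolding Wn Wp by (simp add: algebra_simps move centralD[OF cp, of B] centralD[OF cr, of A])
  have r4: "Q * (G_tilde alg q A B (Suc k) * A) - R * (A * G_tilde alg q A B (Suc k))
      = sc (- (w ^ 2)) * W_neg alg q A B (Suc k) - sc (- (w ^ 2)) * W_pos alg q A B k" for k
    unfolding W_neg_Suc W_summand0_def w_def[symmetric] alg_simps q_commutator_alg rho ..
  have r6: "Q * (B * G_tilde alg q A B (Suc k)) - R * (G_tilde alg q A B (Suc k) * B)
      = sc (- (w ^ 2)) * W_pos alg q A B (Suc k) - sc (- (w ^ 2)) * W_neg alg q A B k" for k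
    unfolding W_pos_Suc W_summand1_def w_def[symmetric] alg_simps q_commutator_alg rho ..
  have pencil: "(z k * x + f k) * (z l * y + f' l) - (z l * y + f' l) * (z k * x + f k)
      = z k * z l * (x * y - y * x)"
    if "\<And>k. central (f k)" "\<And>k. central (f' k)" for f f' k l x y
    using that by (intro commutator_pencil cz)
  show ?thesis
    unfolding alternating_relations_def Let_def w_def[symmetric]
  proof (intro allI conjI, goal_cases)
    \<comment> \<open>Goals 7 to 16 concern brackets of pencils; the first six goals are
      \<open>r1\<close> to \<open>r6\<close>.\<close>
    case (7 k l) show ?case by (simp add: Wn pencil cp)
  next
    case (8 k l) show ?case by (simp add: Wp pencil cr)
  next
    case (9 k l) show ?case by (simp add: Wn Wp pencil cp cr flip: distrib_left)
  next
    case (10 k l) show ?case by (simp add: Wn Gp pencil cp cg flip: distrib_left)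
  next
    \<comment> \<open>The sign rules are switched off so that \<open>- (sc w * C)\<close> stays a
      single entry of the pencil.\<close>
    case (11 k l) show ?case by (simp add: Wn Gt'' pencil cp cg del: mult_minus_right mult_minus_left flip: distrib_left)
  next
    case (12 k l) show ?case by (simp add: Wp Gp pencil cr cg flip: distrib_left)
  next
    case (13 k l) show ?case by (simp add: Wp Gt'' pencil cr cg del: mult_minus_right mult_minus_left flip: distrib_left)
  next
    case (14 k l) show ?case by (simp add: Gp pencil cg)
  next
    case (15 k l) show ?case by (simp add: Gt'' pencil cg del: mult_minus_right mult_minus_left)
  next
    case (16 k l) show ?case by (simp add: Gp Gt'' pencil cg del: mult_minus_right mult_minus_left flip: distrib_left)
  qed (simp_all only: commutator_alg q_commutator_alg alg_simps alg_minus Suc_eq_plus1[symmetric]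
      W0 r1 r2 r3 r4 r5 r6)
qed

end

section \<open>Algebras on a carrier as quotients of a ring type\<close>

text \<open>Type classes such as the one of power series do not apply to an algebra on a carrier set.
  The product of all algebras on a type does not depend on any term, so it can be made a type.
  The extra factor, the ground field, ensures \<open>0 \<noteq> 1\<close> without exhibiting a nontrivial algebra.\<close>

typedef (overloaded) ('f, 'b) alg_prod =
  "UNIV \<times> (\<Pi>\<^sub>E M\<in>{M. f_algebra M}. carrier M) :: ('f::field \<times> (('f, 'b) module \<Rightarrow> 'b)) set"
proof -
  have "\<zero>\<^bsub>M\<^esub> \<in> carrier M" if "f_algebra M" for M :: "('f, 'b) module"
  proof -
    interpret f_algebra M by fact
    show ?thesis by simp
  qed
  then have "(0 :: 'f, \<lambda>M\<in>{M :: ('f, 'b) module. f_algebra M}. \<zero>\<^bsub>M\<^esub>) \<in> UNIV \<times> (\<Pi>\<^sub>E M\<in>{M. f_algebra M}. carrier M)"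
    by auto
  then show ?thesis by blast
qed

definition base :: "('f::field, 'b) alg_prod \<Rightarrow> 'f"
  where "base X = fst (Rep_alg_prod X)"

definition proj :: "('f::field, 'b) module \<Rightarrow> ('f, 'b) alg_prod \<Rightarrow> 'b"
  where "proj M X = snd (Rep_alg_prod X) M"

definition family :: "'f::field \<Rightarrow> (('f, 'b) module \<Rightarrow> 'b) \<Rightarrow> ('f, 'b) alg_prod"
  where "family c F = Abs_alg_prod (c, restrict F {M. f_algebra M})"

lemma proj_closed [simp, intro]: "f_algebra M \<Longrightarrow> proj M X \<in> carrier M"
  using Rep_alg_prod[of X] by (auto simp: proj_def)

lemma family_simps:
  assumes "\<And>M. f_algebra M \<Longrightarrow> F M \<in> carrier M"
  shows "base (family c F) = c" "f_algebra M \<Longrightarrow> proj M (family c F) = F M"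
proof -
  have "(c, restrict F {M. f_algebra M}) \<in> UNIV \<times> (\<Pi>\<^sub>E M\<in>{M. f_algebra M}. carrier M)"
    using assms by auto
  then show "base (family c F) = c" "f_algebra M \<Longrightarrow> proj M (family c F) = F M"
    by (simp_all add: base_def proj_def family_def Abs_alg_prod_inverse)
qed

lemma alg_prod_eqI:
  assumes "base X = base Y" "\<And>M. f_algebra M \<Longrightarrow> proj M X = proj M Y"
  shows "X = Y"
proof -
  have "snd (Rep_alg_prod X) = snd (Rep_alg_prod Y)"
  proof (rule PiE_ext)
    show "snd (Rep_alg_prod X) \<in> (\<Pi>\<^sub>E M\<in>{M. f_algebra M}. carrier M)"
      "snd (Rep_alg_prod Y) \<in> (\<Pi>\<^sub>E M\<in>{M. f_algebra M}. carrier M)"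
      using Rep_alg_prod[of X] Rep_alg_prod[of Y] by (auto simp: mem_Times_iff)
  qed (use assms(2) in \<open>simp add: proj_def\<close>)
  then show ?thesis using assms(1) by (simp add: base_def prod_eq_iff flip: Rep_alg_prod_inject)
qed

instantiation alg_prod :: (field, type) ring_1
begin

definition "0 = family 0 (\<lambda>M. \<zero>\<^bsub>M\<^esub>)"
definition "1 = family 1 (\<lambda>M. \<one>\<^bsub>M\<^esub>)"
definition "X + Y = family (base X + base Y) (\<lambda>M. proj M X \<oplus>\<^bsub>M\<^esub> proj M Y)"
definition "X * Y = family (base X * base Y) (\<lambda>M. proj M X \<otimes>\<^bsub>M\<^esub> proj M Y)"
definition "- X = family (- base X) (\<lambda>M. \<ominus>\<^bsub>M\<^esub> proj M X)"
definition "X - Y = family (base X - base Y) (\<lambda>M. proj M X \<ominus>\<^bsub>M\<^esub> proj M Y)"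

lemma alg_prod_ops:
  "base (0 :: ('a, 'b) alg_prod) = 0" "base (1 :: ('a, 'b) alg_prod) = 1"
  "base (X + Y) = base X + base Y" "base (X * Y) = base X * base Y"
  "base (- X) = - base X" "base (X - Y) = base X - base Y"
  "f_algebra M \<Longrightarrow> proj M 0 = \<zero>\<^bsub>M\<^esub>" "f_algebra M \<Longrightarrow> proj M 1 = \<one>\<^bsub>M\<^esub>"
  "f_algebra M \<Longrightarrow> proj M (X + Y) = proj M X \<oplus>\<^bsub>M\<^esub> proj M Y"
  "f_algebra M \<Longrightarrow> proj M (X * Y) = proj M X \<otimes>\<^bsub>M\<^esub> proj M Y"
  "f_algebra M \<Longrightarrow> proj M (- X) = \<ominus>\<^bsub>M\<^esub> proj M X"
  "f_algebra M \<Longrightarrow> proj M (X - Y) = proj M X \<ominus>\<^bsub>M\<^esub> proj M Y"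
  for X Y :: "('a, 'b) alg_prod" and M :: "('a, 'b) module"
proof -
  have ring: "ring M" if "f_algebra M" for M :: "('a, 'b) module"
    using that by (rule f_algebra.axioms)
  note closed = ring.ring_simprules(1-6)[OF ring] proj_closed
  show "base (0 :: ('a, 'b) alg_prod) = 0" "base (1 :: ('a, 'b) alg_prod) = 1"
    "base (X + Y) = base X + base Y" "base (X * Y) = base X * base Y"
    "base (- X) = - base X" "base (X - Y) = base X - base Y"
    "f_algebra M \<Longrightarrow> proj M 0 = \<zero>\<^bsub>M\<^esub>" "f_algebra M \<Longrightarrow> proj M 1 = \<one>\<^bsub>M\<^esub>"
    "f_algebra M \<Longrightarrow> proj M (X + Y) = proj M X \<oplus>\<^bsub>M\<^esub> proj M Y"
    "f_algebra M \<Longrightarrow> proj M (X * Y) = proj M X \<otimes>\<^bsub>M\<^esub> proj M Y"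
    "f_algebra M \<Longrightarrow> proj M (- X) = \<ominus>\<^bsub>M\<^esub> proj M X"
    "f_algebra M \<Longrightarrow> proj M (X - Y) = proj M X \<ominus>\<^bsub>M\<^esub> proj M Y"
    unfolding zero_alg_prod_def one_alg_prod_def plus_alg_prod_def times_alg_prod_def
      uminus_alg_prod_def minus_alg_prod_def
    by (simp_all add: family_simps closed)
qed

instance
proof
  fix X Y Z :: "('a, 'b) alg_prod"
  have ring: "ring M" if "f_algebra M" for M :: "('a, 'b) module"
    using that by (rule f_algebra.axioms)
  note laws = alg_prod_ops proj_closed ring.ring_simprules(1-9,11-13,15,23)[OF ring]
    monoid.r_one[OF ring.is_monoid[OF ring]]
  show "X + Y + Z = X + (Y + Z)" by (rule alg_prod_eqI) (simp_all add: laws)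
  show "X + Y = Y + X"
    by (rule alg_prod_eqI) (simp_all add: alg_prod_ops ring.ring_simprules(10)[OF ring, of _ "proj _ X"])
  show "0 + X = X" by (rule alg_prod_eqI) (simp_all add: laws)
  show "- X + X = 0" by (rule alg_prod_eqI) (simp_all add: laws)
  show "X - Y = X + - Y" by (rule alg_prod_eqI) (simp_all add: alg_prod_ops a_minus_def)
  show "X * Y * Z = X * (Y * Z)" by (rule alg_prod_eqI) (simp_all add: laws)
  show "1 * X = X" "X * 1 = X" by (rule alg_prod_eqI; simp add: laws)+
  show "(X + Y) * Z = X * Z + Y * Z" "X * (Y + Z) = X * Y + X * Z"
    by (rule alg_prod_eqI; simp add: laws distrib_left distrib_right)+
  show "(0 :: ('a, 'b) alg_prod) \<noteq> 1"
    by (metis alg_prod_ops(1,2) zero_neq_one)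
qed

end

definition scalar :: "'f::field \<Rightarrow> ('f, 'b) alg_prod"
  where "scalar c = family c (\<lambda>M. c \<odot>\<^bsub>M\<^esub> \<one>\<^bsub>M\<^esub>)"

lemma scalar_simps:
  shows base_scalar: "base (scalar c :: ('a::field, 'b) alg_prod) = c"
    and proj_scalar: "f_algebra (M :: ('a, 'b) module) \<Longrightarrow> proj M (scalar c) = c \<odot>\<^bsub>M\<^esub> \<one>\<^bsub>M\<^esub>"
proof -
  have closed: "c \<odot>\<^bsub>M\<^esub> \<one>\<^bsub>M\<^esub> \<in> carrier M" if "f_algebra M" for M :: "('a, 'b) module"
  proof -
    interpret f_algebra M by fact
    show ?thesis by simp
  qed
  show "base (scalar c :: ('a, 'b) alg_prod) = c" unfolding scalar_def by (rule family_simps(1)[where F = "\<lambda>M. c \<odot>\<^bsub>M\<^esub> \<one>\<^bsub>M\<^esub>", OF closed])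
  show "f_algebra M \<Longrightarrow> proj M (scalar c) = c \<odot>\<^bsub>M\<^esub> \<one>\<^bsub>M\<^esub>"
    unfolding scalar_def by (rule family_simps(2)[where F = "\<lambda>M. c \<odot>\<^bsub>M\<^esub> \<one>\<^bsub>M\<^esub>", OF closed])
qed

lemma proj_scalar_mult:
  assumes "f_algebra M"
  shows "proj M (scalar c * X) = c \<odot>\<^bsub>M\<^esub> proj M X" "proj M (X * scalar c) = c \<odot>\<^bsub>M\<^esub> proj M X"
proof -
  interpret f_algebra M by fact
  show "proj M (scalar c * X) = c \<odot>\<^bsub>M\<^esub> proj M X" "proj M (X * scalar c) = c \<odot>\<^bsub>M\<^esub> proj M X"
    using assms by (simp_all add: alg_prod_ops scalar_simps smult_mult_l smult_mult_r)
qed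

interpretation alg_prod: scalars "scalar :: 'f::field \<Rightarrow> ('f, 'b) alg_prod"
proof
  fix x y :: 'f
  have one: "\<one>\<^bsub>M\<^esub> \<in> carrier M" if "f_algebra M" for M :: "('f, 'b) module"
  proof -
    interpret f_algebra M by fact
    show ?thesis by simp
  qed
  note rules = scalar_simps f_algebra.smult_l_distr f_algebra.smult_one f_algebra.smult_assoc1 one
  show "scalar 1 = (1 :: ('f, 'b) alg_prod)"
    by (rule alg_prod_eqI) (simp_all add: alg_prod_ops rules)
  show "scalar (x + y) = scalar x + (scalar y :: ('f, 'b) alg_prod)"
    by (rule alg_prod_eqI) (simp_all add: alg_prod_ops rules)
  show "scalar (x * y) = scalar x * (scalar y :: ('f, 'b) alg_prod)"
    by (rule alg_prod_eqI) (simp_all add: alg_prod_ops(4) proj_scalar_mult(1) rules)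
  show "central (scalar x :: ('f, 'b) alg_prod)"
    unfolding central_def
    by (intro allI alg_prod_eqI) (simp_all add: alg_prod_ops(4) proj_scalar_mult mult.commute)
qed

lemma proj_hom:
  assumes "f_algebra M" shows "proj M \<in> f_algebra_hom alg_prod.alg M"
  using assms by (simp add: f_algebra_hom_def ring_hom_def proj_scalar_mult) (simp add: alg_prod_ops)

text \<open>Extension by zero to the other factors. Three zeros satisfy the Askey-Wilson relations
  with central elements 0, so the relations in one algebra lift to the whole product.\<close>

definition inject :: "('f::field, 'b) module \<Rightarrow> 'b \<Rightarrow> ('f, 'b) alg_prod"
  where "inject M x = family 0 (\<lambda>M'. if M' = M then x else \<zero>\<^bsub>M'\<^esub>)"

lemma proj_inject:
  assumes "x \<in> carrier M" "f_algebra M'"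
  shows "proj M' (inject M x) = (if M' = M then x else \<zero>\<^bsub>M'\<^esub>)"
proof -
  have "(if N = M then x else \<zero>\<^bsub>N\<^esub>) \<in> carrier N" if "f_algebra N" for N
  proof -
    interpret f_algebra N by fact
    show ?thesis using assms(1) by simp
  qed
  from family_simps(2)[where F = "\<lambda>N. if N = M then x else \<zero>\<^bsub>N\<^esub>", OF this assms(2)]
  show ?thesis by (simp add: inject_def)
qed

lemma central_alg_prodI:
  fixes X :: "('f::field, 'b) alg_prod"
  assumes "\<And>M x. f_algebra M \<Longrightarrow> x \<in> carrier M \<Longrightarrow> x \<otimes>\<^bsub>M\<^esub> proj M X = proj M X \<otimes>\<^bsub>M\<^esub> x"
  shows "central X"
  unfolding central_def
proof (intro allI alg_prod_eqI)
  fix Y :: "('f, 'b) alg_prod" and M :: "('f, 'b) module"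
  assume "f_algebra M"
  then show "proj M (Y * X) = proj M (X * Y)" using assms[of M "proj M Y"] by (simp add: alg_prod_ops)
qed (simp add: alg_prod_ops mult.commute)

section \<open>Homomorphisms\<close>

context f_algebra
begin

lemma commutator_closed [simp]: "x \<in> carrier M \<Longrightarrow> y \<in> carrier M \<Longrightarrow> commutator M x y \<in> carrier M"
  by (simp add: commutator_def)

lemma q_commutator_closed [simp]:
  "x \<in> carrier M \<Longrightarrow> y \<in> carrier M \<Longrightarrow> q_commutator M q x y \<in> carrier M"
  by (simp add: q_commutator_def)

lemma commutator_eq_zero_iff:
  "x \<in> carrier M \<Longrightarrow> y \<in> carrier M \<Longrightarrow> commutator M x y = \<zero> \<longleftrightarrow> x \<otimes> y = y \<otimes> x"
  by (simp add: commutator_def)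

lemma smult_zero [simp]: "c \<odot> \<zero> = \<zero>"
  using smult_mult_l[of \<zero> \<zero> c] by simp

lemma q_expansion_closed:
  assumes "q \<noteq> 0" "\<forall>n>0. q ^ n \<noteq> 1" "range a \<subseteq> carrier M" "a 0 = \<one>"
  shows "is_q_expansion M q a (q_expansion M q a)" "q_expansion M q a n \<in> carrier M"
proof -
  show *: "is_q_expansion M q a (q_expansion M q a)"
    unfolding q_expansion_def using theI'[OF ex1_q_expansion[OF assms]] .
  have "generated_subalgebra M (range a) \<subseteq> carrier M"
    using generated_subalgebra_closed(1)[OF assms(3)] by (rule subringE(1))
  then show "q_expansion M q a n \<in> carrier M"
    using * by (auto simp: is_q_expansion_def)
qed

context
  fixes w0 w1 assumes w: "w0 \<in> carrier M" "w1 \<in> carrier M"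
begin

lemma B_delta1_closed: "B_delta1 M q w0 w1 \<in> carrier M"
  using w by (simp add: B_delta1_def)

lemma B_alpha1_closed: "B_alpha1 M q w0 w1 n \<in> carrier M"
  by (induction n rule: induct_nat_012) (simp_all add: w B_delta1_closed B_alpha1.simps)

lemma B_delta_closed: "B_delta M q w0 w1 n \<in> carrier M"
  using B_alpha1_closed w by (cases n rule: B_delta.cases) (auto simp: B_delta1_closed)

lemma B_vee_closed: "B_vee M q w0 w1 n \<in> carrier M"
  by (simp add: B_vee_def B_delta_closed)

end

end

section \<open>Transport of the named elements along homomorphisms\<close>

locale f_alg_hom = M: f_algebra M + N: f_algebra N
  for M :: "('f::field, 'a, 'm) module_scheme" and N :: "('f, 'b, 'n) module_scheme" +
  fixes h
  assumes h: "h \<in> f_algebra_hom M N"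
begin

sublocale ring_hom_ring M N h
  using h by unfold_locales (simp add: f_algebra_hom_def)

lemma hom_smult: "x \<in> carrier M \<Longrightarrow> h (c \<odot>\<^bsub>M\<^esub> x) = c \<odot>\<^bsub>N\<^esub> h x"
  using h by (simp add: f_algebra_hom_def)

lemma hom_minus: "x \<in> carrier M \<Longrightarrow> y \<in> carrier M \<Longrightarrow> h (x \<ominus>\<^bsub>M\<^esub> y) = h x \<ominus>\<^bsub>N\<^esub> h y"
  by (simp add: a_minus_def)

lemma hom_commutator:
  "x \<in> carrier M \<Longrightarrow> y \<in> carrier M \<Longrightarrow> h (commutator M x y) = commutator N (h x) (h y)"
  by (simp add: commutator_def hom_minus)

lemma hom_q_commutator:
  "x \<in> carrier M \<Longrightarrow> y \<in> carrier M \<Longrightarrow> h (q_commutator M q x y) = q_commutator N q (h x) (h y)"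
  by (simp add: q_commutator_def hom_minus hom_smult)

lemma hom_generated_subalgebra:
  assumes "S \<subseteq> carrier M" "x \<in> generated_subalgebra M S"
  shows "h x \<in> generated_subalgebra N (h ` S)"
  unfolding generated_subalgebra_def
proof
  fix T assume T: "T \<in> {T. subring T N \<and> (\<forall>c. \<forall>x\<in>T. c \<odot>\<^bsub>N\<^esub> x \<in> T) \<and> h ` S \<subseteq> T}"
  note sub = subringE[of T N]
  have "subring {x \<in> carrier M. h x \<in> T} M"
    by (rule M.subringI) (use T sub in auto)
  moreover have "c \<odot>\<^bsub>M\<^esub> x \<in> {x \<in> carrier M. h x \<in> T}" if "x \<in> {x \<in> carrier M. h x \<in> T}" for c x
    using that T by (simp add: hom_smult)
  moreover have "S \<subseteq> {x \<in> carrier M. h x \<in> T}" using T assms(1) by auto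
  ultimately show "h x \<in> T"
    using assms(2) unfolding generated_subalgebra_def by blast
qed

text \<open>The q-expansion is given by a description, so it cannot be pushed through h term by
  term. Its image satisfies the recursion and the membership clause in N, and uniqueness there
  identifies it.\<close>

lemma hom_q_expansion:
  assumes q: "q \<noteq> 0" "\<forall>n>0. q ^ n \<noteq> 1" and a: "range a \<subseteq> carrier M" "a 0 = \<one>\<^bsub>M\<^esub>"
  shows "h (q_expansion M q a n) = q_expansion N q (\<lambda>n. h (a n)) n"
proof -
  define b where "b = q_expansion M q a"
  have b: "is_q_expansion M q a b" "b n \<in> carrier M" for n
    unfolding b_def using M.q_expansion_closed[OF q a] by auto
  have a': "a n \<in> carrier M" for n using a by auto
  have "is_q_expansion N q (\<lambda>n. h (a n)) (\<lambda>n. h (b n))"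
    unfolding is_q_expansion_def
  proof (intro conjI allI impI)
    show "range (\<lambda>n. h (b n)) \<subseteq> generated_subalgebra N (range (\<lambda>n. h (a n)))"
      using hom_generated_subalgebra[OF a(1)] b(1) unfolding is_q_expansion_def
      by (auto simp: image_image)
    show "h (b 0) = \<one>\<^bsub>N\<^esub>" using b(1) by (simp add: is_q_expansion_def)
  next
    fix n :: nat assume n: "1 \<le> n"
    let ?t = "\<lambda>(j, k, l). ((-1) ^ l * of_nat ((k + l) choose l) * qint q (2 * n - j)
          * qint q 2 ^ (k + 1)) \<odot>\<^bsub>M\<^esub> (a j \<otimes>\<^bsub>M\<^esub> b (k + 1))"
    let ?T = "{(j, k, l). j + k + 2 * l + 1 = n}"
    have t: "?t \<in> ?T \<rightarrow> carrier M" using a' b(2) by auto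
    have "h \<zero>\<^bsub>M\<^esub> = h (qint q n \<odot>\<^bsub>M\<^esub> a n \<oplus>\<^bsub>M\<^esub> finsum M ?t ?T)"
      by (rule arg_cong[where f = h, OF
            b(1)[unfolded is_q_expansion_def, THEN conjunct2, THEN conjunct2, rule_format, OF n]])
    also have "\<dots> = qint q n \<odot>\<^bsub>N\<^esub> h (a n) \<oplus>\<^bsub>N\<^esub> finsum N (h \<circ> ?t) ?T"
      using t a' by (simp only: hom_add M.smult_closed M.finsum_closed hom_smult hom_finsum)
    also have "h \<circ> ?t = (\<lambda>(j, k, l). ((-1) ^ l * of_nat ((k + l) choose l) * qint q (2 * n - j)
          * qint q 2 ^ (k + 1)) \<odot>\<^bsub>N\<^esub> (h (a j) \<otimes>\<^bsub>N\<^esub> h (b (k + 1))))"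
      using a' b(2) by (auto simp: hom_smult fun_eq_iff)
    finally show "\<zero>\<^bsub>N\<^esub> = qint q n \<odot>\<^bsub>N\<^esub> h (a n) \<oplus>\<^bsub>N\<^esub>
      finsum N (\<lambda>(j, k, l). ((-1) ^ l * of_nat ((k + l) choose l) * qint q (2 * n - j)
          * qint q 2 ^ (k + 1)) \<odot>\<^bsub>N\<^esub> (h (a j) \<otimes>\<^bsub>N\<^esub> h (b (k + 1)))) ?T"
      by simp
  qed
  moreover have "is_q_expansion N q (\<lambda>n. h (a n)) (q_expansion N q (\<lambda>n. h (a n)))"
    using q a by (intro N.q_expansion_closed) auto
  moreover have "\<exists>!b. is_q_expansion N q (\<lambda>n. h (a n)) b"
    using q a by (intro N.ex1_q_expansion) auto
  ultimately have "(\<lambda>n. h (b n)) = q_expansion N q (\<lambda>n. h (a n))" by blast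
  then show ?thesis unfolding b_def by (rule fun_cong)
qed

context
  fixes q :: 'f and w0 w1
  assumes q: "q \<noteq> 0" "\<forall>n>0. q ^ n \<noteq> 1" and w: "w0 \<in> carrier M" "w1 \<in> carrier M"
begin

lemma hom_B_delta1: "h (B_delta1 M q w0 w1) = B_delta1 N q (h w0) (h w1)"
  using w by (simp add: B_delta1_def hom_minus hom_smult)

lemma hom_B_alpha1: "h (B_alpha1 M q w0 w1 n) = B_alpha1 N q (h w0) (h w1) n"
  by (induction n rule: induct_nat_012)
    (simp_all add: w B_alpha1.simps M.B_delta1_closed M.B_alpha1_closed hom_B_delta1 hom_minus hom_smult
      hom_commutator)

lemma hom_B_delta: "h (B_delta M q w0 w1 n) = B_delta N q (h w0) (h w1) n"
proof (cases n rule: B_delta.cases)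
  case (3 m)
  have "h \<circ> (\<lambda>l. B_alpha1 M q w0 w1 l \<otimes>\<^bsub>M\<^esub> B_alpha1 M q w0 w1 (m - l))
    = (\<lambda>l. B_alpha1 N q (h w0) (h w1) l \<otimes>\<^bsub>N\<^esub> B_alpha1 N q (h w0) (h w1) (m - l))"
    using w by (simp add: fun_eq_iff M.B_alpha1_closed hom_B_alpha1)
  then show ?thesis
    using w by (simp add: 3 M.B_alpha1_closed hom_B_alpha1 hom_minus hom_smult)
qed (simp_all add: hom_smult hom_B_delta1)

lemma hom_B_vee: "h (B_vee M q w0 w1 n) = B_vee N q (h w0) (h w1) n"
  using w by (simp add: B_vee_def hom_smult M.B_delta_closed hom_B_delta)

lemma B_vee_M: "range (B_vee M q w0 w1) \<subseteq> carrier M" "B_vee M q w0 w1 0 = \<one>\<^bsub>M\<^esub>"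
  using M.B_vee_closed[OF w] inverse_square_neq_1[OF q]
  by (auto simp: B_vee_def simp flip: M.smult_assoc1)

lemma G_tilde_closed: "G_tilde M q w0 w1 n \<in> carrier M"
  by (simp add: G_tilde_def M.q_expansion_closed[OF q B_vee_M])

lemma hom_G_tilde: "h (G_tilde M q w0 w1 n) = G_tilde N q (h w0) (h w1) n"
proof -
  have "(\<lambda>n. h (B_vee M q w0 w1 n)) = B_vee N q (h w0) (h w1)"
    by (simp add: fun_eq_iff hom_B_vee)
  then show ?thesis
    by (simp add: G_tilde_def hom_smult M.q_expansion_closed[OF q B_vee_M] hom_q_expansion[OF q B_vee_M])
qed

lemma W_summand_closed: "W_summand0 M q w0 w1 n \<in> carrier M" "W_summand1 M q w0 w1 n \<in> carrier M"
  using w by (simp_all add: W_summand0_def W_summand1_def G_tilde_closed)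

lemma hom_W_summand:
  "h (W_summand0 M q w0 w1 n) = W_summand0 N q (h w0) (h w1) n"
  "h (W_summand1 M q w0 w1 n) = W_summand1 N q (h w0) (h w1) n"
  using w by (simp_all add: W_summand0_def W_summand1_def G_tilde_closed hom_smult hom_q_commutator hom_G_tilde)

lemma W_closed: "W_neg M q w0 w1 k \<in> carrier M" "W_pos M q w0 w1 k \<in> carrier M"
  using w by (simp_all add: W_neg_def W_pos_def Let_def W_summand_closed)

lemma hom_W:
  "h (W_neg M q w0 w1 k) = W_neg N q (h w0) (h w1) k"
  "h (W_pos M q w0 w1 k) = W_pos N q (h w0) (h w1) k"
  using w by (simp_all add: W_neg_def W_pos_def Let_def W_summand_closed hom_minus hom_W_summand comp_def)

lemma G_closed: "G M q w0 w1 k \<in> carrier M"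
  using w by (simp add: G_def G_tilde_closed W_closed)

lemma hom_G: "h (G M q w0 w1 k) = G N q (h w0) (h w1) k"
  using w by (simp add: G_def G_tilde_closed W_closed hom_smult hom_commutator hom_W hom_G_tilde)

lemma hom_alternating_relations:
  assumes rel: "alternating_relations M q (W_neg M q w0 w1) (W_pos M q w0 w1) (G M q w0 w1)
    (\<lambda>k. G_tilde M q w0 w1 (k + 1))"
  shows "alternating_relations N q (W_neg N q (h w0) (h w1)) (W_pos N q (h w0) (h w1)) (G N q (h w0) (h w1))
    (\<lambda>k. G_tilde N q (h w0) (h w1) (k + 1))"
proof -
  note closed = W_closed G_closed G_tilde_closed M.commutator_closed M.q_commutator_closed
    M.minus_closed M.smult_closed
  \<comment> \<open>Used backwards: each expression in N is folded into the image under h of the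
    corresponding expression in M, where \<open>rel\<close> applies.\<close>
  note hom = hom_W[symmetric] hom_G[symmetric] hom_G_tilde[symmetric] hom_commutator[symmetric]
    hom_q_commutator[symmetric] hom_minus[symmetric] hom_smult[symmetric] hom_add[symmetric]
    hom_zero[symmetric]
  show ?thesis
    using rel unfolding alternating_relations_def Let_def
    by (simp only: hom closed simp_thms)
qed

end

end

section \<open>Presented algebras\<close>

context
  fixes S :: "('g fword \<Rightarrow>\<^sub>0 'f::field) set"
begin

interpretation free: f_algebra "free_algebra :: ('f, 'g fword \<Rightarrow>\<^sub>0 'f) module"
  by (rule f_algebra_free_algebra)

lemma ideal_genideal: "ideal (Idl\<^bsub>free_algebra\<^esub> S) free_algebra"
  by (rule free.genideal_ideal) simp

interpretation ideal "Idl\<^bsub>free_algebra\<^esub> S" free_algebra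
  by (rule ideal_genideal)

lemma f_algebra_hom_presented:
  "(\<lambda>x. Idl\<^bsub>free_algebra\<^esub> S +>\<^bsub>free_algebra\<^esub> x) \<in> f_algebra_hom free_algebra (presented_algebra S)"
  unfolding f_algebra_hom_def ring_hom_def presented_algebra_def
    free.quotient_algebra_simps(1-5)[OF ideal_genideal]
  using free.quotient_algebra_simps(6)[OF ideal_genideal] a_rcos_sum rcoset_mult_add
  by (auto simp: A_RCOSETS_def')

lemma presented_relation:
  assumes "x \<in> S"
  shows "Idl\<^bsub>free_algebra\<^esub> S +>\<^bsub>free_algebra\<^esub> x = \<zero>\<^bsub>presented_algebra S\<^esub>"
proof -
  have "x \<in> Idl\<^bsub>free_algebra\<^esub> S" using free.genideal_self[of S] assms by auto
  then show ?thesis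
    by (simp add: presented_algebra_def free.quotient_algebra_simps(4)[OF ideal_genideal] a_rcos_const)
qed

lemma presented_surj:
  assumes "X \<in> carrier (presented_algebra S)"
  shows "\<exists>x. X = Idl\<^bsub>free_algebra\<^esub> S +>\<^bsub>free_algebra\<^esub> x"
  using assms
  by (auto simp: presented_algebra_def free.quotient_algebra_simps(1)[OF ideal_genideal] A_RCOSETS_def')

end

lemma free_algebra_induct [case_names scalar gen add mult]:
  fixes x :: "'g fword \<Rightarrow>\<^sub>0 'f::field"
  assumes sc: "\<And>c. P (Poly_Mapping.single 0 c)" and gen: "\<And>g. P (free_gen g)"
    and add: "\<And>x y. P x \<Longrightarrow> P y \<Longrightarrow> P (x + y)" and mult: "\<And>x y. P x \<Longrightarrow> P y \<Longrightarrow> P (x * y)"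
  shows "P x"
proof -
  have word: "P (Poly_Mapping.single (Fword ws) 1)" for ws
  proof (induction ws)
    case Nil
    then show ?case using sc[of 1] by (simp add: zero_fword_def)
  next
    case (Cons g ws)
    have "free_gen g * Poly_Mapping.single (Fword ws) 1 = (Poly_Mapping.single (Fword (g # ws)) 1 :: 'g fword \<Rightarrow>\<^sub>0 'f)"
      by (simp add: free_gen_def mult_single)
    then show ?case using mult[OF gen Cons.IH] by metis
  qed
  have single: "P (Poly_Mapping.single w c)" for w c
  proof (cases w)
    case (Fword ws)
    have "Poly_Mapping.single 0 c * Poly_Mapping.single w 1 = (Poly_Mapping.single w c :: 'g fword \<Rightarrow>\<^sub>0 'f)"
      by (simp add: mult_single)
    then show ?thesis using mult[OF sc word[of ws]] Fword by metis
  qed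
  show ?thesis
  proof (induction x rule: update_induct)
    case const
    then show ?case using sc[of 0] by simp
  next
    case (update f a b)
    have "Poly_Mapping.update a b f = f + Poly_Mapping.single a b"
      using update(1) by (intro poly_mapping_eqI) (auto simp: lookup_update lookup_add lookup_single in_keys_iff)
    then show ?case using add[OF update.IH single] by metis
  qed
qed

text \<open>The elements commuting with y form a subalgebra, so generators suffice. This upgrades
  commutation of the Casimir element with A, B, C to centrality.\<close>

lemma presented_commute_gens:
  fixes S :: "('g fword \<Rightarrow>\<^sub>0 'f::field) set"
  defines "P \<equiv> presented_algebra S"
  assumes y: "y \<in> carrier P" and gens: "\<And>g. presented_gen S g \<otimes>\<^bsub>P\<^esub> y = y \<otimes>\<^bsub>P\<^esub> presented_gen S g"
    and x: "x \<in> carrier P"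
  shows "x \<otimes>\<^bsub>P\<^esub> y = y \<otimes>\<^bsub>P\<^esub> x"
proof -
  interpret P: f_algebra P unfolding P_def by (rule f_algebra_presented_algebra)
  let ?h = "\<lambda>x. Idl\<^bsub>free_algebra\<^esub> S +>\<^bsub>free_algebra\<^esub> x"
  interpret f_alg_hom free_algebra P ?h
    unfolding P_def
    by (intro f_alg_hom.intro f_alg_hom_axioms.intro f_algebra_free_algebra
        f_algebra_presented_algebra f_algebra_hom_presented)
  have closed: "?h z \<in> carrier P" for z by (rule hom_closed) simp
  have h_add: "?h (u + v) = ?h u \<oplus>\<^bsub>P\<^esub> ?h v" and h_mult: "?h (u * v) = ?h u \<otimes>\<^bsub>P\<^esub> ?h v" for u v
    using hom_add[of u v] hom_mult[of u v] by simp_all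
  have scal: "?h (Poly_Mapping.single 0 c) = c \<odot>\<^bsub>P\<^esub> \<one>\<^bsub>P\<^esub>" for c
    using hom_smult[of 1 c] hom_one by (simp add: smult_free_algebra)
  have "?h z \<otimes>\<^bsub>P\<^esub> y = y \<otimes>\<^bsub>P\<^esub> ?h z" for z
  proof (induction z rule: free_algebra_induct)
    case (scalar c)
    then show ?case using y by (simp add: scal P.smult_mult_l P.smult_mult_r)
  next
    case (gen g)
    then show ?case using gens[of g] by (simp add: presented_gen_def)
  next
    case (add u v)
    then show ?case using y closed by (simp add: h_add P.l_distr P.r_distr)
  next
    case (mult u v)
    have "?h u \<otimes>\<^bsub>P\<^esub> ?h v \<otimes>\<^bsub>P\<^esub> y = ?h u \<otimes>\<^bsub>P\<^esub> y \<otimes>\<^bsub>P\<^esub> ?h v"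
      using y closed mult(2) by (simp add: P.m_assoc)
    then show ?case using y closed mult(1) by (simp add: h_mult P.m_assoc)
  qed
  moreover obtain z where "x = ?h z" using x presented_surj unfolding P_def by blast
  ultimately show ?thesis by simp
qed

section \<open>The relations in an algebra on a carrier set\<close>

lemma (in f_alg_hom) hom_aw_central:
  "x \<in> carrier M \<Longrightarrow> y \<in> carrier M \<Longrightarrow> z \<in> carrier M \<Longrightarrow>
    h (aw_central M q x y z) = aw_central N q (h x) (h y) (h z)"
  by (simp add: aw_central_def hom_smult hom_q_commutator)

lemma (in f_algebra) aw_central_zero: "aw_central M q \<zero> \<zero> \<zero> = \<zero>"
  by (simp add: aw_central_def q_commutator_def a_minus_def)

text \<open>The assumption \<open>gens\<close> expresses generation by a, b, c through commutants.
  The three elements are lifted to the product ring, the relations are proved there, and the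
  projection to M brings them back.\<close>

lemma f_algebra_alternating_relations:
  fixes M :: "('f::field, 'b) module" and q :: 'f
  assumes M: "f_algebra M" and q: "q \<noteq> 0" "\<forall>n>0. q ^ n \<noteq> 1"
    and abc: "a \<in> carrier M" "b \<in> carrier M" "c \<in> carrier M"
    and gens: "\<And>x y. x \<in> carrier M \<Longrightarrow> y \<in> carrier M \<Longrightarrow> a \<otimes>\<^bsub>M\<^esub> y = y \<otimes>\<^bsub>M\<^esub> a \<Longrightarrow>
      b \<otimes>\<^bsub>M\<^esub> y = y \<otimes>\<^bsub>M\<^esub> b \<Longrightarrow> c \<otimes>\<^bsub>M\<^esub> y = y \<otimes>\<^bsub>M\<^esub> c \<Longrightarrow> x \<otimes>\<^bsub>M\<^esub> y = y \<otimes>\<^bsub>M\<^esub> x"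
    and cent: "\<And>x z. x \<in> carrier M \<Longrightarrow>
      z \<in> {aw_central M q a b c, aw_central M q b c a, aw_central M q c a b} \<Longrightarrow> x \<otimes>\<^bsub>M\<^esub> z = z \<otimes>\<^bsub>M\<^esub> x"
  shows "alternating_relations M q (W_neg M q a b) (W_pos M q a b) (G M q a b) (\<lambda>k. G_tilde M q a b (k + 1))"
proof -
  define A B C where "A = inject M a" and "B = inject M b" and "C = inject M c"
  let ?alg = "alg_prod.alg :: ('f, ('f, 'b) alg_prod) module"
  define al be ga where "al = aw_central ?alg q A B C" and "be = aw_central ?alg q B C A"
    and "ga = aw_central ?alg q C A B"
  note ABC_defs = A_def B_def C_def
  have hom: "f_alg_hom ?alg N (proj N)" if "f_algebra N" for N
    using that by (intro f_alg_hom.intro f_alg_hom_axioms.intro alg_prod.alg.f_algebra_axioms proj_hom)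
  have projABC: "proj N A = (if N = M then a else \<zero>\<^bsub>N\<^esub>)" "proj N B = (if N = M then b else \<zero>\<^bsub>N\<^esub>)"
    "proj N C = (if N = M then c else \<zero>\<^bsub>N\<^esub>)" if "f_algebra N" for N
    using that abc by (simp_all add: ABC_defs proj_inject)
  have proj_al: "proj N al = (if N = M then aw_central M q a b c else \<zero>\<^bsub>N\<^esub>)"
    "proj N be = (if N = M then aw_central M q b c a else \<zero>\<^bsub>N\<^esub>)"
    "proj N ga = (if N = M then aw_central M q c a b else \<zero>\<^bsub>N\<^esub>)" if N: "f_algebra N" for N
    unfolding al_def be_def ga_def
    using N by (simp_all add: f_alg_hom.hom_aw_central[OF hom] projABC f_algebra.aw_central_zero)
  \<comment> \<open>An element supported in the factor M is central as soon as its component in M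
    is.\<close>
  have central_lift: "central X"
    if X: "\<And>N. f_algebra N \<Longrightarrow> proj N X = (if N = M then z else \<zero>\<^bsub>N\<^esub>)"
      and z: "\<And>x. x \<in> carrier M \<Longrightarrow> x \<otimes>\<^bsub>M\<^esub> z = z \<otimes>\<^bsub>M\<^esub> x" for X z
  proof (rule central_alg_prodI)
    fix N :: "('f, 'b) module" and x assume N: "f_algebra N" and x: "x \<in> carrier N"
    interpret N: f_algebra N by fact
    show "x \<otimes>\<^bsub>N\<^esub> proj N X = proj N X \<otimes>\<^bsub>N\<^esub> x"
      using X[OF N] z x by auto
  qed
  have central: "central al" "central be" "central ga"
    by (rule central_lift, erule proj_al, rule cent, assumption, simp)+
  interpret q_scalars "scalar :: 'f \<Rightarrow> ('f, 'b) alg_prod" q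
    by unfold_locales (use q in auto)
  have w: "q ^ 2 - inverse q ^ 2 \<noteq> 0" using q_power_neq[of 2] by simp
  have rel: "scalar q * (y * z) - scalar (inverse q) * (z * y)
      = (scalar q * scalar q - scalar (inverse q) * scalar (inverse q)) * (aw_central ?alg q x y z - x)"
    for x y z :: "('f, 'b) alg_prod"
  proof -
    have "scalar q * scalar q - scalar (inverse q) * scalar (inverse q)
      = (scalar (q ^ 2 - inverse q ^ 2) :: ('f, 'b) alg_prod)"
      by (simp add: alg_prod.sc_diff alg_prod.sc_mult power2_eq_square)
    then show ?thesis using w
      by (simp add: aw_central_def flip: mult.assoc alg_prod.sc_mult)
  qed
  interpret aw_triple "scalar q" "scalar (inverse q)" A B C al be ga
    using q central rel by unfold_locales
      (simp_all add: al_def be_def ga_def alg_prod.central_sc flip: alg_prod.sc_mult)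
  have "central Casimir"
  proof (rule central_lift)
    fix N :: "('f, 'b) module" assume N: "f_algebra N"
    interpret N: f_algebra N by fact
    show "proj N Casimir = (if N = M then proj M Casimir else \<zero>\<^bsub>N\<^esub>)"
    proof (cases "N = M")
      \<comment> \<open>In the other factors every term of the Casimir element contains a
        zero.\<close>
      case False
      then show ?thesis
        unfolding Casimir_def using N by (simp add: alg_prod_ops projABC proj_al N.minus_eq)
    qed simp
  next
    fix x assume x: "x \<in> carrier M"
    have "proj M (A * Casimir) = proj M (Casimir * A)" "proj M (B * Casimir) = proj M (Casimir * B)"
      "proj M (C * Casimir) = proj M (Casimir * C)"
      by (simp_all only: Casimir_commute)
    then have "a \<otimes>\<^bsub>M\<^esub> proj M Casimir = proj M Casimir \<otimes>\<^bsub>M\<^esub> a"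
      "b \<otimes>\<^bsub>M\<^esub> proj M Casimir = proj M Casimir \<otimes>\<^bsub>M\<^esub> b"
      "c \<otimes>\<^bsub>M\<^esub> proj M Casimir = proj M Casimir \<otimes>\<^bsub>M\<^esub> c"
      by (simp_all only: alg_prod_ops(10)[OF M] projABC[OF M] simp_thms if_True)
    then show "x \<otimes>\<^bsub>M\<^esub> proj M Casimir = proj M Casimir \<otimes>\<^bsub>M\<^esub> x"
      by (rule gens[OF x proj_closed[OF M]])
  qed
  then interpret aw_algebra scalar q A B C al be ga
    by unfold_locales
  have "alternating_relations M q (W_neg M q (proj M A) (proj M B)) (W_pos M q (proj M A) (proj M B))
    (G M q (proj M A) (proj M B)) (\<lambda>k. G_tilde M q (proj M A) (proj M B) (k + 1))"
    by (rule f_alg_hom.hom_alternating_relations[OF hom[OF M] q _ _ alternating_relations_alg]) simp_all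
  then show ?thesis using M by (simp add: projABC)
qed

lemma universal_AW_relations:
  assumes q: "q \<noteq> 0" "\<forall>n>0. q ^ n \<noteq> 1"
  shows "alternating_relations (universal_AW q) q (W_neg (universal_AW q) q (AW_A q) (AW_B q))
    (W_pos (universal_AW q) q (AW_A q) (AW_B q)) (G (universal_AW q) q (AW_A q) (AW_B q))
    (\<lambda>k. G_tilde (universal_AW q) q (AW_A q) (AW_B q) (k + 1))"
proof (rule f_algebra_alternating_relations[OF _ q])
  let ?S = "aw_relators q" and ?D = "universal_AW q"
  let ?h = "\<lambda>x. Idl\<^bsub>free_algebra\<^esub> ?S +>\<^bsub>free_algebra\<^esub> x"
  let ?C = "presented_gen ?S Gen_C"
  interpret D: f_algebra ?D
    unfolding universal_AW_def by (rule f_algebra_presented_algebra)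
  interpret f_alg_hom free_algebra ?D ?h
    unfolding universal_AW_def
    by (intro f_alg_hom.intro f_alg_hom_axioms.intro f_algebra_free_algebra
        f_algebra_presented_algebra f_algebra_hom_presented)
  have closed: "?h x \<in> carrier ?D" for x by (rule hom_closed) simp
  have gens: "AW_A q = ?h (free_gen Gen_A)" "AW_B q = ?h (free_gen Gen_B)" "?C = ?h (free_gen Gen_C)"
    by (simp_all add: AW_A_def AW_B_def presented_gen_def)
  show "f_algebra ?D" by (rule D.f_algebra_axioms)
  show "AW_A q \<in> carrier ?D" "AW_B q \<in> carrier ?D" "?C \<in> carrier ?D"
    unfolding gens by (rule closed)+
  show "x \<otimes>\<^bsub>?D\<^esub> y = y \<otimes>\<^bsub>?D\<^esub> x"
    if "x \<in> carrier ?D" "y \<in> carrier ?D" "AW_A q \<otimes>\<^bsub>?D\<^esub> y = y \<otimes>\<^bsub>?D\<^esub> AW_A q"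
      "AW_B q \<otimes>\<^bsub>?D\<^esub> y = y \<otimes>\<^bsub>?D\<^esub> AW_B q" "?C \<otimes>\<^bsub>?D\<^esub> y = y \<otimes>\<^bsub>?D\<^esub> ?C" for x y
  proof -
    have "presented_gen ?S g \<otimes>\<^bsub>?D\<^esub> y = y \<otimes>\<^bsub>?D\<^esub> presented_gen ?S g" for g
      using that(3-5) by (cases g) (simp_all add: AW_A_def AW_B_def)
    then show ?thesis
      using presented_commute_gens[of y ?S x] that(1,2) by (simp add: universal_AW_def)
  qed
  show "x \<otimes>\<^bsub>?D\<^esub> z = z \<otimes>\<^bsub>?D\<^esub> x"
    if x: "x \<in> carrier ?D" and z: "z \<in> {aw_central ?D q (AW_A q) (AW_B q) ?C,
      aw_central ?D q (AW_B q) ?C (AW_A q), aw_central ?D q ?C (AW_A q) (AW_B q)}" for x z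
  proof -
    obtain u where u: "x = ?h u"
      using x presented_surj[of x ?S] by (auto simp: universal_AW_def)
    have "z \<in> ?h ` {aw_central free_algebra q (free_gen Gen_A) (free_gen Gen_B) (free_gen Gen_C),
        aw_central free_algebra q (free_gen Gen_B) (free_gen Gen_C) (free_gen Gen_A),
        aw_central free_algebra q (free_gen Gen_C) (free_gen Gen_A) (free_gen Gen_B)}"
      using z unfolding gens by (simp add: hom_aw_central)
    then obtain v where v: "z = ?h v"
      "v \<in> {aw_central free_algebra q (free_gen Gen_A) (free_gen Gen_B) (free_gen Gen_C),
        aw_central free_algebra q (free_gen Gen_B) (free_gen Gen_C) (free_gen Gen_A),
        aw_central free_algebra q (free_gen Gen_C) (free_gen Gen_A) (free_gen Gen_B)}"
      by blast
    \<comment> \<open>The relators contain the commutators of v with all elements u of the free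
      algebra, so the image of v commutes with everything at once.\<close>
    have "commutator free_algebra v u \<in> ?S" using v(2) unfolding aw_relators_def by blast
    then have "?h (commutator free_algebra v u) = \<zero>\<^bsub>?D\<^esub>"
      unfolding universal_AW_def by (rule presented_relation)
    then have "commutator ?D z x = \<zero>\<^bsub>?D\<^esub>"
      by (simp add: hom_commutator u v(1))
    then show ?thesis using closed by (simp add: D.commutator_eq_zero_iff u v(1))
  qed
qed

theorem theorem7p6:
  fixes q :: "'f::field"
    and \<phi> :: "(onsager_gen fword \<Rightarrow>\<^sub>0 'f) set \<Rightarrow> (aw_gen fword \<Rightarrow>\<^sub>0 'f) set"
    and Wn Wp Gp Gt :: "nat \<Rightarrow> (aw_gen fword \<Rightarrow>\<^sub>0 'f) set"
  assumes q_nonzero: "q \<noteq> 0"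
    and q_not_root_of_unity: "\<forall>n>0. q ^ n \<noteq> 1"
    and hom: "\<phi> \<in> f_algebra_hom (q_onsager q) (universal_AW q)"
    and hom_W0: "\<phi> (onsager_W0 q) = AW_A q"
    and hom_W1: "\<phi> (onsager_W1 q) = AW_B q"
  defines "\<Delta> \<equiv> universal_AW q"
    and "\<rho> \<equiv> - ((q ^ 2 - inverse q ^ 2) ^ 2)"
    and "Wn \<equiv> (\<lambda>k. \<phi> (W_neg (q_onsager q) q (onsager_W0 q) (onsager_W1 q) k))"
    and "Wp \<equiv> (\<lambda>k. \<phi> (W_pos (q_onsager q) q (onsager_W0 q) (onsager_W1 q) k))"
    and "Gp \<equiv> (\<lambda>k. \<phi> (G (q_onsager q) q (onsager_W0 q) (onsager_W1 q) k))"
    and "Gt \<equiv> (\<lambda>k. \<phi> (G_tilde (q_onsager q) q (onsager_W0 q) (onsager_W1 q) (k + 1)))"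
  shows "\<forall>k l.
    commutator \<Delta> (Wn 0) (Wp k) = commutator \<Delta> (Wn k) (Wp 0) \<and>
    commutator \<Delta> (Wn k) (Wp 0) = inverse (q + inverse q) \<odot>\<^bsub>\<Delta>\<^esub> (Gt k \<ominus>\<^bsub>\<Delta>\<^esub> Gp k) \<and>
    q_commutator \<Delta> q (Wn 0) (Gp k) = q_commutator \<Delta> q (Gt k) (Wn 0) \<and>
    q_commutator \<Delta> q (Gt k) (Wn 0) = \<rho> \<odot>\<^bsub>\<Delta>\<^esub> Wn (k + 1) \<ominus>\<^bsub>\<Delta>\<^esub> \<rho> \<odot>\<^bsub>\<Delta>\<^esub> Wp k \<and>
    q_commutator \<Delta> q (Gp k) (Wp 0) = q_commutator \<Delta> q (Wp 0) (Gt k) \<and>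
    q_commutator \<Delta> q (Wp 0) (Gt k) = \<rho> \<odot>\<^bsub>\<Delta>\<^esub> Wp (k + 1) \<ominus>\<^bsub>\<Delta>\<^esub> \<rho> \<odot>\<^bsub>\<Delta>\<^esub> Wn k \<and>
    commutator \<Delta> (Wn k) (Wn l) = \<zero>\<^bsub>\<Delta>\<^esub> \<and>
    commutator \<Delta> (Wp k) (Wp l) = \<zero>\<^bsub>\<Delta>\<^esub> \<and>
    commutator \<Delta> (Wn k) (Wp l) \<oplus>\<^bsub>\<Delta>\<^esub> commutator \<Delta> (Wp k) (Wn l) = \<zero>\<^bsub>\<Delta>\<^esub> \<and>
    commutator \<Delta> (Wn k) (Gp l) \<oplus>\<^bsub>\<Delta>\<^esub> commutator \<Delta> (Gp k) (Wn l) = \<zero>\<^bsub>\<Delta>\<^esub> \<and>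
    commutator \<Delta> (Wn k) (Gt l) \<oplus>\<^bsub>\<Delta>\<^esub> commutator \<Delta> (Gt k) (Wn l) = \<zero>\<^bsub>\<Delta>\<^esub> \<and>
    commutator \<Delta> (Wp k) (Gp l) \<oplus>\<^bsub>\<Delta>\<^esub> commutator \<Delta> (Gp k) (Wp l) = \<zero>\<^bsub>\<Delta>\<^esub> \<and>
    commutator \<Delta> (Wp k) (Gt l) \<oplus>\<^bsub>\<Delta>\<^esub> commutator \<Delta> (Gt k) (Wp l) = \<zero>\<^bsub>\<Delta>\<^esub> \<and>
    commutator \<Delta> (Gp k) (Gp l) = \<zero>\<^bsub>\<Delta>\<^esub> \<and>
    commutator \<Delta> (Gt k) (Gt l) = \<zero>\<^bsub>\<Delta>\<^esub> \<and>
    commutator \<Delta> (Gt k) (Gp l) \<oplus>\<^bsub>\<Delta>\<^esub> commutator \<Delta> (Gp k) (Gt l) = \<zero>\<^bsub>\<Delta>\<^esub>"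
proof -
  interpret O: f_algebra "q_onsager q"
    unfolding q_onsager_def by (rule f_algebra_presented_algebra)
  interpret f_alg_hom "q_onsager q" "universal_AW q" \<phi>
    using hom unfolding universal_AW_def
    by (intro f_alg_hom.intro f_alg_hom_axioms.intro O.f_algebra_axioms
        f_algebra_presented_algebra)
  have closed: "presented_gen (onsager_relators q) g \<in> carrier (q_onsager q)" for g
    using f_algebra_hom_presented[of "onsager_relators q"]
    by (auto simp: presented_gen_def q_onsager_def f_algebra_hom_def ring_hom_def)
  then have w: "onsager_W0 q \<in> carrier (q_onsager q)" "onsager_W1 q \<in> carrier (q_onsager q)"
    by (simp_all add: onsager_W0_def onsager_W1_def)
  note q = q_nonzero q_not_root_of_unity
  \<comment> \<open>Each named element of O_q is mapped to the same formula evaluated at A and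
    B.\<close>
  have "alternating_relations \<Delta> q Wn Wp Gp Gt"
    unfolding \<Delta>_def Wn_def Wp_def Gp_def Gt_def hom_W[OF q w] hom_G[OF q w] hom_G_tilde[OF q w]
      hom_W0 hom_W1
    using universal_AW_relations[OF q] by simp
  then show ?thesis
    unfolding alternating_relations_def Let_def \<rho>_def .
qed

end
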